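(* There are no solutions to $(PT)^3=I$ in the association schemes of $N \times N$ alternating forms over a finite field of order $q$ if $N>5$.
   Context: The association scheme of $N\times N$ alternating forms over the finite field of order $q$ is a self-dual P-polynomial association scheme. $P$ denotes its first eigenmatrix (character table), with entries $P_j(i)$, $0\le i,j\le$ number of classes; $I$ is the identity matrix; and $T=\mathrm{diag}(T_0,T_1,\dots)$ ranges over diagonal matrices of the same size as $P$. A "solution to $(PT)^3=I$" means such a diagonal matrix $T$ satisfying this matrix equation. *)

theory Defs
  imports Complex_Main "Jordan_Normal_Form.DL_Rank"
begin

text \<open>
  A scheme with \<open>d\<close> classes on a finite set \<open>X\<close> is given by its relations
  \<open>R 0, \<dots>, R d\<close>. Complex matrices with rows and columns indexed by \<open>X\<close> are functions
  \<open>'x \<Rightarrow> 'x \<Rightarrow> complex\<close>, of which only the values on \<open>X \<times> X\<close> matter.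
\<close>

definition adj :: "('x \<times> 'x) set \<Rightarrow> 'x \<Rightarrow> 'x \<Rightarrow> complex" where
  "adj S x y = (if (x, y) \<in> S then 1 else 0)"

definition bose_mesner ::
  "'x set \<Rightarrow> (nat \<Rightarrow> ('x \<times> 'x) set) \<Rightarrow> nat \<Rightarrow> ('x \<Rightarrow> 'x \<Rightarrow> complex) set" where
  "bose_mesner X R d =
     {M. \<exists>c. \<forall>x\<in>X. \<forall>y\<in>X. M x y = (\<Sum>k\<le>d. c k * adj (R k) x y)}"

text \<open>
  An ordering \<open>E 0, \<dots>, E d\<close> of the primitive idempotents of the Bose-Mesner algebra, with
  \<open>E 0 = J / |X|\<close>. As this algebra has dimension \<open>d + 1\<close>, a family of \<open>d + 1\<close> nonzero, mutually
  orthogonal idempotents consists of all primitive ones.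
\<close>

definition primitive_idempotents ::
  "'x set \<Rightarrow> (nat \<Rightarrow> ('x \<times> 'x) set) \<Rightarrow> nat \<Rightarrow> (nat \<Rightarrow> 'x \<Rightarrow> 'x \<Rightarrow> complex) \<Rightarrow> bool" where
  "primitive_idempotents X R d E \<longleftrightarrow>
     (\<forall>i\<le>d. E i \<in> bose_mesner X R d) \<and>
     (\<forall>i\<le>d. \<exists>x\<in>X. \<exists>y\<in>X. E i x y \<noteq> 0) \<and>
     (\<forall>i\<le>d. \<forall>j\<le>d. \<forall>x\<in>X. \<forall>z\<in>X.
        (\<Sum>y\<in>X. E i x y * E j y z) = (if i = j then E i x z else 0)) \<and>
     (\<forall>x\<in>X. \<forall>y\<in>X. (\<Sum>i\<le>d. E i x y) = (if x = y then 1 else 0)) \<and>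
     (\<forall>x\<in>X. \<forall>y\<in>X. E 0 x y = 1 / of_nat (card X))"

text \<open>
  The entry \<open>(i, j)\<close> of the first eigenmatrix \<open>P\<close> is the eigenvalue \<open>P\<^sub>j(i)\<close> of the
  adjacency matrix of \<open>R j\<close> on the column space of \<open>E i\<close>; the entry \<open>(k, i)\<close> of the second
  eigenmatrix \<open>Q\<close> is \<open>Q\<^sub>i(k)\<close>.
\<close>

definition first_eigenmatrix ::
  "'x set \<Rightarrow> (nat \<Rightarrow> ('x \<times> 'x) set) \<Rightarrow> nat \<Rightarrow> (nat \<Rightarrow> 'x \<Rightarrow> 'x \<Rightarrow> complex) \<Rightarrow> complex mat \<Rightarrow> bool" where
  "first_eigenmatrix X R d E P \<longleftrightarrow>
     P \<in> carrier_mat (d + 1) (d + 1) \<and>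
     (\<forall>j\<le>d. \<forall>x\<in>X. \<forall>y\<in>X. adj (R j) x y = (\<Sum>i\<le>d. P $$ (i, j) * E i x y))"

definition second_eigenmatrix ::
  "'x set \<Rightarrow> (nat \<Rightarrow> ('x \<times> 'x) set) \<Rightarrow> nat \<Rightarrow> (nat \<Rightarrow> 'x \<Rightarrow> 'x \<Rightarrow> complex) \<Rightarrow> complex mat \<Rightarrow> bool" where
  "second_eigenmatrix X R d E Q \<longleftrightarrow>
     Q \<in> carrier_mat (d + 1) (d + 1) \<and>
     (\<forall>i\<le>d. \<forall>x\<in>X. \<forall>y\<in>X.
        E i x y = (\<Sum>k\<le>d. Q $$ (k, i) * adj (R k) x y) / of_nat (card X))"

text \<open>
  For a self-dual scheme the first eigenmatrix is taken with respect to an ordering of the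
  primitive idempotents for which the two eigenmatrices agree, equivalently
  \<open>P\<^sup>2 = |X| I\<close>. Without this the order of the rows of \<open>P\<close> would be arbitrary.
\<close>

definition self_dual_eigenmatrix ::
  "'x set \<Rightarrow> (nat \<Rightarrow> ('x \<times> 'x) set) \<Rightarrow> nat \<Rightarrow> complex mat \<Rightarrow> bool" where
  "self_dual_eigenmatrix X R d P \<longleftrightarrow>
     (\<exists>E. primitive_idempotents X R d E \<and>
          first_eigenmatrix X R d E P \<and> second_eigenmatrix X R d E P)"

text \<open>
  The zero diagonal has to be required separately because of characteristic 2.
\<close>

definition alt_forms :: "nat \<Rightarrow> 'a :: field mat set" where
  "alt_forms N =
     {A \<in> carrier_mat N N. transpose_mat A = - A \<and> (\<forall>i<N. A $$ (i, i) = 0)}"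

text \<open>
  Alternating matrices have even rank, so the classes are numbered by half the rank, from
  \<open>0\<close> to \<open>N div 2\<close>.
\<close>

definition alt_rel :: "nat \<Rightarrow> nat \<Rightarrow> ('a :: field mat \<times> 'a mat) set" where
  "alt_rel N i =
     {(A, B). A \<in> alt_forms N \<and> B \<in> alt_forms N \<and> vec_space.rank N (A - B) = 2 * i}"

end

theory Submission
  imports Defs "HOL-Library.Cardinality"
begin

text \<open>
  The adjacency matrix of pairs at rank distance 2 is, up to a multiple of the identity, the sum
  over all vectors \<open>u\<close>, \<open>v\<close> of the translations by \<open>u v\<^sup>t - v u\<^sup>t\<close>. Counting how
  such a translation changes the rank gives the tridiagonal intersection matrix \<open>L\<close>, and
  \<open>L P = P G\<close> with \<open>G\<close> the diagonal matrix of the eigenvalues. Rows 1 and 2 express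
  \<open>P\<^sub>1(2)\<close> and \<open>P\<^sub>1(3)\<close> by \<open>P\<^sub>1(1)\<close>, and \<open>P\<^sub>1(1)\<close> itself turns out to be a root of a polynomial
  that splits into known linear factors and a cubic; the cubic is positive in the range allowed by
  the positive semidefiniteness of the translation sum.

  If \<open>(P T)\<^sup>3 = 1\<close> and \<open>S\<close> is the inverse of \<open>T\<close>, both \<open>S P S\<close> and \<open>T P T\<close> commute with
  \<open>L\<close>. The entries of these commutation relations in rows 1 and 2 and columns 0 and 1 give a
  linear and a quadratic equation for \<open>w = r + 1 / r\<close>, where \<open>r = T\<^sub>0 / T\<^sub>1\<close>. Their resultant is a
  product of nonzero factors as soon as there are at least three classes.
\<close>

subsection \<open>Subspaces and orthogonal complements over a finite field\<close>

text \<open>\<open>self_dual_eigenmatrix\<close> fixes the order of the idempotents only through the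
  equality of the two eigenmatrices and the choice of \<open>E 0\<close>, so the usual eigenvalue
  formulas cannot be quoted; the numbers have to be forced from self-duality. It puts the same
  matrix \<open>P\<close> into \<open>L P = P G\<close> (columns of \<open>P\<close> are
  eigenfunctions) and, since the square of \<open>P\<close> is scalar, into the dual relation
  \<open>G P = P L\<close>. The dual relation writes column 2 of \<open>P\<close> as a quadratic in
  column 1, and the entry of the first relation in row 2 and column 2 then closes the system for the
  first eigenvalue. This uses row 3, hence three classes.

  Summing over pairs \<open>(u, v)\<close> instead of over matrices of rank 2 avoids counting
  alternating matrices of a given rank: the effect of a pair on the rank depends only on the
  position of \<open>u\<close> and \<open>v\<close> relative to the image of \<open>A\<close>, and
  positions are counted by subspace sizes. The price is a common factor
  \<open>m = q (q^2 - 1)\<close> in all intersection numbers. The same pairs supply positivity,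
  since for fixed \<open>u\<close> the translations form a group.\<close>

definition subsp :: "nat \<Rightarrow> 'a :: field vec set \<Rightarrow> bool" where
  "subsp n S \<longleftrightarrow> S \<subseteq> carrier_vec n \<and> 0\<^sub>v n \<in> S \<and>
     (\<forall>x\<in>S. \<forall>y\<in>S. x + y \<in> S) \<and> (\<forall>c. \<forall>x\<in>S. c \<cdot>\<^sub>v x \<in> S)"

definition adjoin :: "'a :: field vec set \<Rightarrow> 'a vec \<Rightarrow> 'a vec set" where
  "adjoin S u = (\<lambda>(s, c). s + c \<cdot>\<^sub>v u) ` (S \<times> UNIV)"

definition perp :: "nat \<Rightarrow> 'a :: field vec set \<Rightarrow> 'a vec set" where
  "perp n S = {y \<in> carrier_vec n. \<forall>x\<in>S. x \<bullet> y = 0}"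

lemma subspD:
  assumes "subsp n S"
  shows "\<And>x. x \<in> S \<Longrightarrow> x \<in> carrier_vec n" "0\<^sub>v n \<in> S"
    "\<And>x y. x \<in> S \<Longrightarrow> y \<in> S \<Longrightarrow> x + y \<in> S" "\<And>c x. x \<in> S \<Longrightarrow> c \<cdot>\<^sub>v x \<in> S"
    "\<And>x y. x \<in> S \<Longrightarrow> y \<in> S \<Longrightarrow> x - y \<in> S"
proof -
  show 1: "\<And>x. x \<in> S \<Longrightarrow> x \<in> carrier_vec n" "0\<^sub>v n \<in> S"
    and 2: "\<And>x y. x \<in> S \<Longrightarrow> y \<in> S \<Longrightarrow> x + y \<in> S" and 3: "\<And>c x. x \<in> S \<Longrightarrow> c \<cdot>\<^sub>v x \<in> S"
    using assms by (auto simp: subsp_def)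
  fix x y assume "x \<in> S" "y \<in> S"
  then have "x + (-1) \<cdot>\<^sub>v y \<in> S" using 2 3 by blast
  moreover have "x + (-1) \<cdot>\<^sub>v y = x - y"
    using 1(1)[OF \<open>x \<in> S\<close>] 1(1)[OF \<open>y \<in> S\<close>] by (intro eq_vecI) auto
  ultimately show "x - y \<in> S" by simp
qed

lemma finite_carrier_vec [simp]: "finite (carrier_vec n :: 'a :: finite vec set)"
proof -
  have "(carrier_vec n :: 'a vec set) \<subseteq> vec_of_list ` {xs. set xs \<subseteq> UNIV \<and> length xs = n}"
  proof
    fix x :: "'a vec" assume "x \<in> carrier_vec n"
    then show "x \<in> vec_of_list ` {xs. set xs \<subseteq> UNIV \<and> length xs = n}"
      by (intro image_eqI[of _ _ "list_of_vec x"]) (auto simp: vec_list)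
  qed
  moreover have "finite {xs :: 'a list. set xs \<subseteq> UNIV \<and> length xs = n}"
    by (rule finite_lists_length_eq) simp
  ultimately show ?thesis using finite_surj by blast
qed

lemma card_carrier_vec: "card (carrier_vec n :: 'a :: finite vec set) = CARD('a) ^ n"
proof -
  have "bij_betw vec_of_list {xs :: 'a list. set xs \<subseteq> UNIV \<and> length xs = n} (carrier_vec n)"
  proof (rule bij_betwI[of _ _ _ list_of_vec])
    show "vec_of_list \<in> {xs :: 'a list. set xs \<subseteq> UNIV \<and> length xs = n} \<rightarrow> carrier_vec n"
      by (auto intro: carrier_vecI)
    show "list_of_vec \<in> carrier_vec n \<rightarrow> {xs :: 'a list. set xs \<subseteq> UNIV \<and> length xs = n}"
      by auto
  qed (simp_all add: list_vec vec_list)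
  then show ?thesis
    using card_lists_length_eq[of "UNIV :: 'a set" n] by (simp add: bij_betw_same_card)
qed

lemma subsp_carrier: "subsp n (carrier_vec n)"
  by (auto simp: subsp_def)

lemma subsp_finite: "subsp n (S :: 'a :: {field, finite} vec set) \<Longrightarrow> finite S"
  using finite_carrier_vec finite_subset unfolding subsp_def by blast

lemma subsp_perp: "S \<subseteq> carrier_vec n \<Longrightarrow> subsp n (perp n S)"
  by (auto simp: subsp_def perp_def scalar_prod_add_distrib[of _ n])

lemma subsp_adjoin:
  assumes S: "subsp n S" and u: "u \<in> carrier_vec n"
  shows "subsp n (adjoin S u)"
proof -
  note D = subspD[OF S]
  have a: "s + c \<cdot>\<^sub>v u + (t + d \<cdot>\<^sub>v u) = (s + t) + (c + d) \<cdot>\<^sub>v u" if "s \<in> S" "t \<in> S" for s t c d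
    using D(1)[OF that(1)] D(1)[OF that(2)] u by (intro eq_vecI) (auto simp: algebra_simps)
  have m: "d \<cdot>\<^sub>v (s + c \<cdot>\<^sub>v u) = d \<cdot>\<^sub>v s + (d * c) \<cdot>\<^sub>v u" if "s \<in> S" for s c d
    using D(1)[OF that] u by (intro eq_vecI) (auto simp: algebra_simps)
  have z: "0\<^sub>v n = 0\<^sub>v n + 0 \<cdot>\<^sub>v u" using u by (intro eq_vecI) auto
  show ?thesis
    unfolding subsp_def
  proof (intro conjI ballI allI)
    show "adjoin S u \<subseteq> carrier_vec n" using D(1) u by (auto simp: adjoin_def)
    show "0\<^sub>v n \<in> adjoin S u" 
      unfolding adjoin_def by (rule image_eqI[of _ _ "(0\<^sub>v n, 0)"]) (use z D(2) in simp_all)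
    fix x assume "x \<in> adjoin S u"
    then obtain s c where x: "s \<in> S" "x = s + c \<cdot>\<^sub>v u" by (auto simp: adjoin_def)
    show "d \<cdot>\<^sub>v x \<in> adjoin S u" for d
      unfolding adjoin_def x(2)
      by (rule image_eqI[of _ _ "(d \<cdot>\<^sub>v s, d * c)"]) (use m[OF x(1)] D(4)[OF x(1)] in simp_all)
    fix y assume "y \<in> adjoin S u"
    then obtain t d where y: "t \<in> S" "y = t + d \<cdot>\<^sub>v u" by (auto simp: adjoin_def)
    show "x + y \<in> adjoin S u"
      unfolding adjoin_def x(2) y(2)
      by (rule image_eqI[of _ _ "(s + t, c + d)"]) (use a[OF x(1) y(1)] D(3)[OF x(1) y(1)] in simp_all)
  qed
qed

lemma card_adjoin:
  fixes S :: "'a :: {field, finite} vec set"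
  assumes S: "subsp n S" and u: "u \<in> carrier_vec n" "u \<notin> S"
  shows "card (adjoin S u) = CARD('a) * card S"
proof -
  note D = subspD[OF S]
  have "inj_on (\<lambda>(s, c). s + c \<cdot>\<^sub>v u) (S \<times> UNIV)"
  proof (rule inj_onI, clarify)
    fix s t c d assume st: "s \<in> S" "t \<in> S" and eq: "s + c \<cdot>\<^sub>v u = t + d \<cdot>\<^sub>v u"
    have c: "s \<in> carrier_vec n" "t \<in> carrier_vec n" using D st by auto
    have e: "s $ i + c * u $ i = t $ i + d * u $ i" if "i < n" for i
      using arg_cong[OF eq, of "\<lambda>v. v $ i"] that c u by auto
    have cd: "c = d"
    proof (rule ccontr)
      assume "c \<noteq> d"
      have "u = inverse (c - d) \<cdot>\<^sub>v (t - s)"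
        using c u e \<open>c \<noteq> d\<close> by (intro eq_vecI) (auto simp: field_simps)
      then show False using D(4)[OF D(5)[OF st(2,1)]] u by metis
    qed
    then have "s = t" using c e by (intro eq_vecI) auto
    with cd show "s = t \<and> c = d" by simp
  qed
  then show ?thesis
    unfolding adjoin_def by (simp add: card_image card_cartesian_product mult.commute)
qed

text \<open>Translation by a multiple of \<open>w\<close> carries one fibre of the linear form
  \<open>x \<bullet> y\<close> injectively into any other, so all \<open>CARD('a)\<close> fibres
  have the same size.\<close>

lemma card_fibre:
  fixes S :: "'a :: {field, finite} vec set"
  assumes S: "subsp n S" and y: "y \<in> carrier_vec n" and w: "w \<in> S" "w \<bullet> y \<noteq> 0"
  shows "CARD('a) * card {x\<in>S. x \<bullet> y = c} = card S"
proof -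
  note D = subspD[OF S]
  have fin: "finite S" using S by (rule subsp_finite)
  have eq: "card {x\<in>S. x \<bullet> y = c} = card {x\<in>S. x \<bullet> y = d}" for c d
  proof -
    define z where "z e = (e / (w \<bullet> y)) \<cdot>\<^sub>v w" for e
    have z: "z e \<in> S" "z e \<bullet> y = e" for e
      using w D(1,4) y by (auto simp: z_def)
    have le: "card {x\<in>S. x \<bullet> y = c} \<le> card {x\<in>S. x \<bullet> y = d}" for c d
    proof (rule card_inj_on_le[of "\<lambda>x. x + z (d - c)"])
      show "inj_on (\<lambda>x. x + z (d - c)) {x \<in> S. x \<bullet> y = c}"
      proof (rule inj_onI)
        fix s t assume "s \<in> {x \<in> S. x \<bullet> y = c}" "t \<in> {x \<in> S. x \<bullet> y = c}"
          and e: "s + z (d - c) = t + z (d - c)"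
        then have c: "s \<in> carrier_vec n" "t \<in> carrier_vec n" "z (d - c) \<in> carrier_vec n"
          using D(1) z(1) by auto
        have "s $ i = t $ i" if "i < n" for i
          using arg_cong[OF e, of "\<lambda>v. v $ i"] that c by auto
        then show "s = t" using c by (intro eq_vecI) auto
      qed
      show "(\<lambda>x. x + z (d - c)) ` {x \<in> S. x \<bullet> y = c} \<subseteq> {x \<in> S. x \<bullet> y = d}"
        using z[of "d - c"] D(1,3) y by (auto simp: add_scalar_prod_distrib[of _ n])
      show "finite {x \<in> S. x \<bullet> y = d}" using fin by simp
    qed
    then show ?thesis by (simp add: order_antisym)
  qed
  have "card S = card (\<Union>d\<in>UNIV. {x\<in>S. x \<bullet> y = d})" by (rule arg_cong[of _ _ card]) auto
  also have "\<dots> = (\<Sum>d\<in>UNIV. card {x\<in>S. x \<bullet> y = d})"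
    using fin by (intro card_UN_disjoint) auto
  also have "\<dots> = (\<Sum>d\<in>(UNIV::'a set). card {x\<in>S. x \<bullet> y = c})" using eq by (intro sum.cong) auto
  finally show ?thesis by simp
qed

lemma ex_scalar_prod_ne_0:
  assumes y: "(y :: 'a :: field vec) \<in> carrier_vec n" and "y \<noteq> 0\<^sub>v n"
  shows "\<exists>x\<in>carrier_vec n. x \<bullet> y \<noteq> 0"
proof -
  obtain i where i: "i < n" "y $ i \<noteq> 0"
    using assms by (metis eq_vecI carrier_vecD index_zero_vec)
  then have "unit_vec n i \<bullet> y = y $ i" using y by (simp add: scalar_prod_left_unit)
  then show ?thesis using i by (intro bexI[of _ "unit_vec n i"]) auto
qed

text \<open>Over a finite field there are isotropic vectors, so \<open>S\<close> and
  \<open>perp n S\<close> may intersect and no direct sum is available. Instead the orthogonal pairs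
  \<open>(x, y)\<close> with \<open>x \<in> S\<close> are counted twice, with
  \<open>card_fibre\<close> for every nonzero \<open>x\<close> and for every \<open>y\<close>
  outside \<open>perp n S\<close>; cancelling \<open>CARD('a) - 1\<close> leaves the product
  formula.\<close>

lemma card_perp:
  fixes S :: "'a :: {field, finite} vec set"
  assumes S: "subsp n S"
  shows "card S * card (perp n S) = CARD('a) ^ n"
proof -
  let ?V = "carrier_vec n :: 'a vec set" and ?q = "CARD('a)" and ?O = "perp n S"
  note D = subspD[OF S]
  have fin: "finite S" using S by (rule subsp_finite)
  have O: "?O \<subseteq> ?V" by (auto simp: perp_def)
  then have finO: "finite ?O" using finite_subset finite_carrier_vec by blast
  have cO: "card ?O \<le> ?q ^ n" using card_mono[OF _ O] card_carrier_vec[of n, where 'a='a] by simp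
  have Spos: "card S \<ge> 1" using fin D(2) by (simp add: card_gt_0_iff Suc_le_eq, blast)
  have "?q * card {y\<in>?V. x \<bullet> y = 0} = (if x = 0\<^sub>v n then ?q else 1) * ?q ^ n" if x: "x \<in> S" for x
  proof (cases "x = 0\<^sub>v n")
    case True
    then have "{y\<in>?V. x \<bullet> y = 0} = ?V" by auto
    then show ?thesis using True by (simp add: card_carrier_vec)
  next
    case False
    obtain w where w: "w \<in> ?V" "w \<bullet> x \<noteq> 0"
      using ex_scalar_prod_ne_0[OF D(1)[OF x] False] by blast
    have "{y\<in>?V. x \<bullet> y = 0} = {y\<in>?V. y \<bullet> x = 0}"
      using D(1)[OF x] by (auto simp: comm_scalar_prod[of _ n])
    then show ?thesis using card_fibre[OF subsp_carrier D(1)[OF x] w, of 0] False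
      by (simp add: card_carrier_vec)
  qed
  then have "(\<Sum>x\<in>S. ?q * card {y\<in>?V. x \<bullet> y = 0}) = (\<Sum>x\<in>S. (if x = 0\<^sub>v n then ?q else 1) * ?q ^ n)"
    by (intro sum.cong) auto
  also have "\<dots> = (\<Sum>x\<in>insert (0\<^sub>v n) (S - {0\<^sub>v n}). (if x = 0\<^sub>v n then ?q else 1) * ?q ^ n)"
    using D(2) by (simp add: insert_absorb)
  also have "\<dots> = ?q * ?q ^ n + (card S - 1) * ?q ^ n"
    using fin D(2) by (subst sum.insert) (auto simp: card_Diff_singleton)
  finally have 1: "(\<Sum>x\<in>S. ?q * card {y\<in>?V. x \<bullet> y = 0}) = ?q * ?q ^ n + (card S - 1) * ?q ^ n" .
  have "?q * card {x\<in>S. x \<bullet> y = 0} = (if y \<in> ?O then ?q else 1) * card S" if y: "y \<in> ?V" for y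
  proof (cases "y \<in> ?O")
    case True
    then have "{x\<in>S. x \<bullet> y = 0} = S" by (auto simp: perp_def)
    then show ?thesis using True by simp
  next
    case False
    then obtain w where "w \<in> S" "w \<bullet> y \<noteq> 0" using y by (auto simp: perp_def)
    then show ?thesis using card_fibre[OF S y, of w 0] False by simp
  qed
  then have "(\<Sum>y\<in>?V. ?q * card {x\<in>S. x \<bullet> y = 0}) = (\<Sum>y\<in>?V. (if y \<in> ?O then ?q else 1) * card S)"
    by (intro sum.cong) auto
  also have "\<dots> = (\<Sum>y\<in>?O. ?q * card S) + (\<Sum>y\<in>?V - ?O. card S)"
    using sum.subset_diff[OF O, of "\<lambda>y. (if y \<in> ?O then ?q else 1) * card S"]
    by (auto simp: add.commute intro!: arg_cong2[of _ _ _ _ "(+)"] sum.cong)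
  also have "\<dots> = card ?O * (?q * card S) + (?q ^ n - card ?O) * card S"
    using O finO by (simp add: card_Diff_subset card_carrier_vec)
  finally have 2: "(\<Sum>y\<in>?V. ?q * card {x\<in>S. x \<bullet> y = 0}) = card ?O * (?q * card S) + (?q ^ n - card ?O) * card S" .
  have "(\<Sum>x\<in>S. card {y\<in>?V. x \<bullet> y = 0}) = (\<Sum>y\<in>?V. card {x\<in>S. x \<bullet> y = 0})"
    using fin by (intro sum_multicount_gen) auto
  then have "(\<Sum>x\<in>S. ?q * card {y\<in>?V. x \<bullet> y = 0}) = (\<Sum>y\<in>?V. ?q * card {x\<in>S. x \<bullet> y = 0})"
    by (simp flip: sum_distrib_left)
  with 1 2 have 3: "?q * ?q ^ n + (card S - 1) * ?q ^ n = card ?O * (?q * card S) + (?q ^ n - card ?O) * card S"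
    by simp
  have "int ?q * int (?q ^ n) + (int (card S) - 1) * int (?q ^ n)
      = int (card ?O) * (int ?q * int (card S)) + (int (?q ^ n) - int (card ?O)) * int (card S)"
    using arg_cong[OF 3, of int] Spos cO by (simp add: of_nat_diff)
  then have "(int ?q - 1) * (int (card S) * int (card ?O)) = (int ?q - 1) * int (?q ^ n)"
    by (simp add: algebra_simps)
  moreover have "int ?q - 1 \<noteq> 0"
  proof -
    have "card {0, 1 :: 'a} \<le> ?q" by (rule card_mono) auto
    then show ?thesis by simp
  qed
  ultimately have "int (card S) * int (card ?O) = int (?q ^ n)" by simp
  then show ?thesis by (metis of_nat_eq_iff of_nat_mult)
qed

text \<open>One inclusion is clear, and \<open>card_perp\<close> for \<open>S\<close> and for
  \<open>perp n S\<close> makes both sides equally large.\<close>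

lemma perp_perp:
  fixes S :: "'a :: {field, finite} vec set"
  assumes S: "subsp n S"
  shows "perp n (perp n S) = S"
proof -
  note D = subspD[OF S]
  have P: "subsp n (perp n S)" using D by (intro subsp_perp) auto
  have "S \<subseteq> perp n (perp n S)"
    using D(1) by (auto simp: perp_def comm_scalar_prod[of _ n])
  moreover have "card (perp n (perp n S)) = card S"
  proof -
    have "card (perp n S) * card S = card (perp n S) * card (perp n (perp n S))"
      using card_perp[OF S] card_perp[OF P] by (simp add: mult.commute)
    moreover have "card (perp n S) \<noteq> 0"
      using card_perp[OF P] by (intro notI) simp
    ultimately show ?thesis by simp
  qed
  moreover have "finite (perp n (perp n S))" 
    by (rule subsp_finite[OF subsp_perp]) (use subspD(1)[OF P] in blast)
  ultimately show ?thesis using card_subset_eq by metis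
qed

text \<open>Translates ranks into set sizes, so that ranks can be compared through images. Each
  vector of a maximal independent set of columns multiplies the size of the span by
  \<open>CARD('a)\<close>, by \<open>card_adjoin\<close>.\<close>

lemma card_image_rank:
  fixes A :: "'a :: {field, finite} mat"
  assumes A: "A \<in> carrier_mat n nc"
  shows "card ((\<lambda>x. A *\<^sub>v x) ` carrier_vec nc) = CARD('a) ^ vec_space.rank n A"
proof -
  interpret vec_space "TYPE('a)" n .
  have C: "set (cols A) \<subseteq> carrier_vec n" using cols_dim A by blast
  obtain U where U: "maximal U (\<lambda>T. T \<subseteq> set (cols A) \<and> lin_indpt T)"
    using maximal_exists_superset[of "set (cols A)" "\<lambda>T. T \<subseteq> set (cols A) \<and> lin_indpt T" "{}"]
    by (auto simp: lin_dep_def)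
  have r: "rank A = card U" by (rule rank_card_indpt[OF A U])
  have Us: "U \<subseteq> set (cols A)" and Ul: "lin_indpt U" using U by (auto simp: maximal_def)
  then have fU: "finite U" and UC: "U \<subseteq> carrier_vec n" using C finite_subset by auto
  have "set (cols A) \<subseteq> span U"
  proof
    fix s assume s: "s \<in> set (cols A)"
    show "s \<in> span U"
    proof (cases "s \<in> U")
      case True then show ?thesis using UC span_mem by auto
    next
      case False
      show ?thesis
      proof (rule ccontr)
        assume "s \<notin> span U"
        then have "lin_indpt (U \<union> {s})"
          using lin_dep_iff_in_span[of U s] UC Ul False s C by auto
        then have "insert s U = U" using U s Us by (auto simp: maximal_def)
        then show False using False by blast
      qed
    qed
  qed
  then have "span (set (cols A)) = span U"
    using span_is_subset span_is_submodule UC Us span_is_monotone by (metis subset_antisym)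
  moreover have "span (set (cols A)) = (\<lambda>x. A *\<^sub>v x) ` carrier_vec nc"
    using col_space_eq[OF A] A unfolding col_space_def by auto
  moreover have "card (span U) = CARD('a) ^ card U"
    using fU UC Ul
  proof (induction U rule: finite_induct)
    case empty
    then show ?case by (simp add: span_empty)
  next
    case (insert v U)
    have U: "U \<subseteq> carrier_vec n" and v: "v \<in> carrier_vec n" using insert.prems by auto
    have l: "lin_indpt U" using insert.prems(2) supset_ld_is_ld by blast
    have v': "v \<notin> span U"
      using lin_dep_iff_in_span[of U v] U v l insert.prems insert.hyps by auto
    have s: "subsp n (span U)"
      using span_is_submodule[of U] U span_closed[of U] unfolding subsp_def submodule_def
      by (auto simp: module_vec_simps)
    have "span (insert v U) = adjoin (span U) v"
    proof -
      have *: "lincomb a (insert v U) = lincomb a U + a v \<cdot>\<^sub>v v" for a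
      proof -
        have "lincomb a (insert v U) = a v \<cdot>\<^sub>v v + lincomb a U"
          using lincomb_insert2[OF insert.hyps(1) U _ insert.hyps(2) v, of a] by simp
        then show ?thesis using v U by (simp add: comm_add_vec[of _ n])
      qed
      show ?thesis
      proof (intro equalityI subsetI)
        fix x assume "x \<in> span (insert v U)"
        then obtain a where a: "x = lincomb a (insert v U)"
          using finite_in_span[of "insert v U" x] insert U v by auto
        show "x \<in> adjoin (span U) v"
          using in_spanI[OF refl insert.hyps(1) subset_refl, of a] unfolding a * adjoin_def by force
      next
        fix x assume "x \<in> adjoin (span U) v"
        then obtain s c where x: "s \<in> span U" "x = s + c \<cdot>\<^sub>v v" by (auto simp: adjoin_def)
        obtain a where a: "s = lincomb a U" using finite_in_span[OF insert.hyps(1) _ x(1)] U by auto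
        have "lincomb (a(v := c)) U = lincomb a U"
          using insert.hyps U by (intro lincomb_cong) auto
        then have "x = lincomb (a(v := c)) (insert v U)" unfolding * x(2) a by simp
        then show "x \<in> span (insert v U)" using insert.hyps(1) by (auto intro!: in_spanI)
      qed
    qed
    then show ?case using card_adjoin[OF s v v'] insert.IH[OF U l] insert.hyps by simp
  qed
  ultimately show ?thesis using r by simp
qed

subsection \<open>Alternating matrices and rank-two perturbations\<close>

definition wedge :: "nat \<Rightarrow> 'a :: field vec \<Rightarrow> 'a vec \<Rightarrow> 'a mat" where
  "wedge n u v = mat n n (\<lambda>(i, j). u $ i * v $ j - v $ i * u $ j)"

definition mat_im :: "nat \<Rightarrow> 'a :: field mat \<Rightarrow> 'a vec set" where
  "mat_im n A = (\<lambda>x. A *\<^sub>v x) ` carrier_vec n"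

text \<open>An alternating \<open>A\<close> induces on its image the alternating form sending
  \<open>(A a, A b)\<close> to \<open>a \<bullet> (A b)\<close>; these are the pairs on which it
  takes the value 1. Two preimages \<open>a\<close> of \<open>u\<close> differ by a kernel vector,
  which is orthogonal to the image, so the choice of \<open>a\<close> does not matter. These turn
  out to be exactly the pairs whose wedge lowers the rank when subtracted.\<close>

definition lower_pairs :: "nat \<Rightarrow> 'a :: field mat \<Rightarrow> ('a vec \<times> 'a vec) set" where
  "lower_pairs n A = {(u, v). v \<in> mat_im n A \<and> (\<exists>a\<in>carrier_vec n. A *\<^sub>v a = u \<and> a \<bullet> v = 1)}"

text \<open>The pairs that are linearly independent modulo the image; they are the ones that raise
  the rank.\<close>

definition raise_pairs :: "nat \<Rightarrow> 'a :: field mat \<Rightarrow> ('a vec \<times> 'a vec) set" where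
  "raise_pairs n A = {(u, v). u \<in> carrier_vec n \<and> v \<in> carrier_vec n \<and>
     u \<notin> mat_im n A \<and> v \<notin> adjoin (mat_im n A) u}"

lemma adjoinI: "s \<in> S \<Longrightarrow> s + c \<cdot>\<^sub>v u \<in> adjoin S u"
  unfolding adjoin_def by (rule image_eqI[of _ _ "(s, c)"]) simp_all

lemma alt_forms_carrier: "A \<in> alt_forms n \<Longrightarrow> A \<in> carrier_mat n n"
  by (simp add: alt_forms_def)

lemma alt_forms_index:
  assumes "A \<in> alt_forms n" "i < n" "j < n"
  shows "A $$ (i, j) = - A $$ (j, i)" "A $$ (i, i) = 0"
proof -
  have "transpose_mat A $$ (j, i) = (- A) $$ (j, i)" "A \<in> carrier_mat n n"
    using assms by (auto simp: alt_forms_def)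
  then show "A $$ (i, j) = - A $$ (j, i)" using assms by simp
  show "A $$ (i, i) = 0" using assms by (simp add: alt_forms_def)
qed

lemma alt_formsI:
  assumes "A \<in> carrier_mat n n" "\<And>i j. i < n \<Longrightarrow> j < n \<Longrightarrow> A $$ (i, j) = - A $$ (j, i)"
    "\<And>i. i < n \<Longrightarrow> A $$ (i, i) = 0"
  shows "A \<in> alt_forms n"
proof -
  have "transpose_mat A = - A"
  proof (rule eq_matI)
    fix i j assume "i < dim_row (- A)" "j < dim_col (- A)"
    then have ij: "i < n" "j < n" using assms(1) by auto
    then show "transpose_mat A $$ (i, j) = (- A) $$ (i, j)"
      using assms(1) assms(2)[of j i] by simp
  qed (use assms(1) in auto)
  then show ?thesis using assms(1,3) by (simp add: alt_forms_def)
qed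

lemma wedge_alt: "wedge n u v \<in> alt_forms n"
  by (rule alt_formsI) (auto simp: wedge_def)

lemma zero_alt: "0\<^sub>m n n \<in> alt_forms n"
  by (rule alt_formsI) auto

lemma minus_alt: "A \<in> alt_forms n \<Longrightarrow> B \<in> alt_forms n \<Longrightarrow> A - B \<in> alt_forms n"
proof (rule alt_formsI)
  assume A: "A \<in> alt_forms n" and B: "B \<in> alt_forms n"
  note C = alt_forms_carrier[OF A] alt_forms_carrier[OF B]
  show "A - B \<in> carrier_mat n n" using C(2) by (rule minus_carrier_mat)
  fix i j assume ij: "i < n" "j < n"
  have "(A - B) $$ (i, j) = A $$ (i, j) - B $$ (i, j)" "(A - B) $$ (j, i) = A $$ (j, i) - B $$ (j, i)"
    using C ij by auto
  then show "(A - B) $$ (i, j) = - (A - B) $$ (j, i)"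
    using alt_forms_index(1)[OF A ij] alt_forms_index(1)[OF B ij] by simp
next
  assume A: "A \<in> alt_forms n" and B: "B \<in> alt_forms n"
  fix i assume i: "i < n"
  then show "(A - B) $$ (i, i) = 0"
    using alt_forms_index(2)[OF A i i] alt_forms_index(2)[OF B i i]
      alt_forms_carrier[OF A] alt_forms_carrier[OF B] by simp
qed

text \<open>Lets a drop of the rank from \<open>A\<close> to \<open>A - wedge n u v\<close> be read
  as a rise in the opposite direction.\<close>

lemma uminus_wedge:
  assumes "u \<in> carrier_vec n" "A \<in> carrier_mat n n"
  shows "A - wedge n u v - wedge n (- u) v = A"
  using assms by (intro eq_matI) (auto simp: wedge_def)

lemma wedge_mult:
  assumes "u \<in> carrier_vec n" "v \<in> carrier_vec n" "x \<in> carrier_vec n"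
  shows "wedge n u v *\<^sub>v x = (v \<bullet> x) \<cdot>\<^sub>v u - (u \<bullet> x) \<cdot>\<^sub>v v"
proof (intro eq_vecI)
  fix i assume "i < dim_vec ((v \<bullet> x) \<cdot>\<^sub>v u - (u \<bullet> x) \<cdot>\<^sub>v v)"
  then have i: "i < n" using assms by auto
  have "(wedge n u v *\<^sub>v x) $ i = (\<Sum>j<n. (u $ i * v $ j - v $ i * u $ j) * x $ j)"
    using i assms by (simp add: wedge_def scalar_prod_def lessThan_atLeast0)
  also have "\<dots> = (\<Sum>j<n. v $ j * x $ j) * u $ i - (\<Sum>j<n. u $ j * x $ j) * v $ i"
    unfolding sum_distrib_right sum_subtractf[symmetric]
    by (rule sum.cong) (simp_all add: algebra_simps)
  also have "\<dots> = ((v \<bullet> x) \<cdot>\<^sub>v u - (u \<bullet> x) \<cdot>\<^sub>v v) $ i"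
    using i assms by (simp add: scalar_prod_def lessThan_atLeast0)
  finally show "(wedge n u v *\<^sub>v x) $ i = ((v \<bullet> x) \<cdot>\<^sub>v u - (u \<bullet> x) \<cdot>\<^sub>v v) $ i" .
qed (use assms in \<open>auto simp: wedge_def\<close>)

lemma minus_wedge_mult:
  assumes "A \<in> carrier_mat n n" "u \<in> carrier_vec n" "v \<in> carrier_vec n" "x \<in> carrier_vec n"
  shows "(A - wedge n u v) *\<^sub>v x = A *\<^sub>v x - ((v \<bullet> x) \<cdot>\<^sub>v u - (u \<bullet> x) \<cdot>\<^sub>v v)"
  using assms alt_forms_carrier[OF wedge_alt[of n u v]]
  by (simp add: minus_mult_distrib_mat_vec[of _ n n] wedge_mult)

text \<open>In characteristic 2 one cannot halve twice the sum: the off-diagonal terms are cancelled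
  in pairs, and the diagonal terms have to vanish by themselves.\<close>

lemma sum_antisym_zero:
  fixes f :: "nat \<Rightarrow> nat \<Rightarrow> 'a :: field"
  assumes "\<And>i j. i < n \<Longrightarrow> j < n \<Longrightarrow> f i j = - f j i" "\<And>i. i < n \<Longrightarrow> f i i = 0"
  shows "(\<Sum>i<n. \<Sum>j<n. f i j) = 0"
  using assms
proof (induction n)
  case (Suc n)
  have "(\<Sum>i<n. f i n) = (\<Sum>j<n. - f n j)"
    by (intro sum.cong refl Suc.prems(1)) auto
  moreover have "(\<Sum>i<n. \<Sum>j<n. f i j) = 0"
    by (rule Suc.IH) (rule Suc.prems; simp)+
  moreover have "f n n = 0" using Suc.prems(2) by simp
  ultimately show ?case by (simp add: sum.distrib sum_negf)
qed simp

lemma scalar_prod_mult_alt: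
  assumes A: "A \<in> alt_forms n" and x: "x \<in> carrier_vec n" and y: "y \<in> carrier_vec n"
  shows "x \<bullet> (A *\<^sub>v y) = - ((A *\<^sub>v x) \<bullet> y)" "x \<bullet> (A *\<^sub>v x) = 0"
proof -
  note C = alt_forms_carrier[OF A]
  have *: "x \<bullet> (A *\<^sub>v y) = (\<Sum>i<n. \<Sum>j<n. x $ i * (A $$ (i, j) * y $ j))"
    if "x \<in> carrier_vec n" "y \<in> carrier_vec n" for x y
    using that C by (simp add: scalar_prod_def lessThan_atLeast0 sum_distrib_left)
  have "(A *\<^sub>v x) \<bullet> y = y \<bullet> (A *\<^sub>v x)"
    using x y C by (intro comm_scalar_prod[of _ n]) auto
  also have "\<dots> = (\<Sum>i<n. \<Sum>j<n. y $ i * (A $$ (i, j) * x $ j))" by (rule *[OF y x])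
  also have "\<dots> = (\<Sum>j<n. \<Sum>i<n. y $ i * (A $$ (i, j) * x $ j))" by (rule sum.swap)
  also have "\<dots> = (\<Sum>i<n. \<Sum>j<n. - (x $ i * (A $$ (i, j) * y $ j)))"
  proof (intro sum.cong refl)
    fix i j assume "i \<in> {..<n}" "j \<in> {..<n}"
    then have "A $$ (j, i) = - A $$ (i, j)" using alt_forms_index(1)[OF A, of j i] by simp
    then show "y $ j * (A $$ (j, i) * x $ i) = - (x $ i * (A $$ (i, j) * y $ j))" by simp
  qed
  finally show "x \<bullet> (A *\<^sub>v y) = - ((A *\<^sub>v x) \<bullet> y)"
    using *[OF x y] by (simp add: sum_negf)
  show "x \<bullet> (A *\<^sub>v x) = 0"
    unfolding *[OF x x]
  proof (rule sum_antisym_zero[where f = "\<lambda>i j. x $ i * (A $$ (i, j) * x $ j)"])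
    fix i j assume ij: "i < n" "j < n"
    show "x $ i * (A $$ (i, j) * x $ j) = - (x $ j * (A $$ (j, i) * x $ i))"
      unfolding alt_forms_index(1)[OF A ij] by (simp add: mult_ac)
    show "x $ i * (A $$ (i, i) * x $ i) = 0"
      unfolding alt_forms_index(2)[OF A ij] by simp
  qed
qed

lemma subsp_mat_im:
  assumes "A \<in> carrier_mat n n"
  shows "subsp n (mat_im n A)"
proof -
  have "A *\<^sub>v x + A *\<^sub>v y \<in> mat_im n A" if "x \<in> carrier_vec n" "y \<in> carrier_vec n" for x y
    unfolding mat_im_def using that assms
    by (intro image_eqI[of _ _ "x + y"]) (auto simp: mult_add_distrib_mat_vec[of _ n n])
  moreover have "c \<cdot>\<^sub>v (A *\<^sub>v x) \<in> mat_im n A" if "x \<in> carrier_vec n" for x c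
    unfolding mat_im_def using that assms
    by (intro image_eqI[of _ _ "c \<cdot>\<^sub>v x"]) (auto simp: mult_mat_vec[of _ n n])
  moreover have "0\<^sub>v n \<in> mat_im n A"
    unfolding mat_im_def using assms by (intro image_eqI[of _ _ "0\<^sub>v n"]) auto
  ultimately show ?thesis
    unfolding subsp_def using assms by (auto simp: mat_im_def)
qed

text \<open>With \<open>perp_perp\<close> this allows images to be compared through kernels, which
  are easier to compute.\<close>

lemma perp_mat_im:
  assumes A: "A \<in> alt_forms n"
  shows "perp n (mat_im n A) = {x \<in> carrier_vec n. A *\<^sub>v x = 0\<^sub>v n}"
proof -
  note C = alt_forms_carrier[OF A]
  have "A *\<^sub>v x = 0\<^sub>v n" if x: "x \<in> carrier_vec n" and 0: "\<forall>y\<in>carrier_vec n. (A *\<^sub>v y) \<bullet> x = 0" for x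
  proof (rule ccontr)
    assume "A *\<^sub>v x \<noteq> 0\<^sub>v n"
    then obtain y where "y \<in> carrier_vec n" "y \<bullet> (A *\<^sub>v x) \<noteq> 0"
      using ex_scalar_prod_ne_0[of "A *\<^sub>v x" n] C x by auto
    then show False using scalar_prod_mult_alt(1)[OF A _ x] 0 by auto
  qed
  moreover have "(A *\<^sub>v y) \<bullet> x = 0" if "x \<in> carrier_vec n" "A *\<^sub>v x = 0\<^sub>v n" "y \<in> carrier_vec n" for x y
    using scalar_prod_mult_alt(1)[OF A that(3,1)] that by auto
  ultimately show ?thesis
    unfolding perp_def mat_im_def by (intro Collect_cong) blast
qed

lemma card_mat_im:
  fixes A :: "'a :: {field, finite} mat"
  shows "A \<in> carrier_mat n n \<Longrightarrow> card (mat_im n A) = CARD('a) ^ vec_space.rank n A"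
  unfolding mat_im_def by (rule card_image_rank)

lemma card_field_ge_2: "CARD('a :: {field, finite}) \<ge> 2"
proof -
  have "card {0, 1 :: 'a} \<le> CARD('a)" by (rule card_mono) auto
  then show ?thesis by simp
qed

text \<open>Both sides have the same orthogonal complement. If \<open>x\<close> is in the kernel of
  \<open>?M\<close>, then \<open>A x = (v \<bullet> x) u - (u \<bullet> x) v\<close>, and the
  independence of \<open>u\<close> and \<open>v\<close> modulo the image of \<open>A\<close> forces
  both coefficients to be 0.\<close>

lemma mat_im_raise:
  fixes A :: "'a :: {field, finite} mat"
  assumes A: "A \<in> alt_forms n" and uv: "(u, v) \<in> raise_pairs n A"
  shows "mat_im n (A - wedge n u v) = adjoin (adjoin (mat_im n A) u) v"
proof -
  let ?M = "A - wedge n u v" and ?I = "mat_im n A" and ?J = "adjoin (adjoin (mat_im n A) u) v"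
  note C = alt_forms_carrier[OF A]
  have u: "u \<in> carrier_vec n" "u \<notin> ?I" and v: "v \<in> carrier_vec n" "v \<notin> adjoin ?I u"
    using uv by (auto simp: raise_pairs_def)
  have M: "?M \<in> alt_forms n" using A wedge_alt by (rule minus_alt)
  have I: "subsp n ?I" using C by (rule subsp_mat_im)
  have I1: "subsp n (adjoin ?I u)" using I u(1) by (rule subsp_adjoin)
  have J: "subsp n ?J" using I1 v(1) by (rule subsp_adjoin)
  have "perp n ?J = {x \<in> carrier_vec n. ?M *\<^sub>v x = 0\<^sub>v n}"
  proof (intro equalityI subsetI)
    fix x assume x: "x \<in> perp n ?J"
    then have xc: "x \<in> carrier_vec n" and x0: "\<And>s c d. s \<in> ?I \<Longrightarrow> (s + c \<cdot>\<^sub>v u + d \<cdot>\<^sub>v v) \<bullet> x = 0"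
      by (auto simp: perp_def adjoin_def)
    have x1: "s \<bullet> x + c * (u \<bullet> x) + d * (v \<bullet> x) = 0" if s: "s \<in> ?I" for s c d
      using x0[OF s, of c d] subspD(1)[OF I s] u v xc
      by (simp add: add_scalar_prod_distrib[of _ n] add.assoc)
    have "s \<bullet> x = 0" if "s \<in> ?I" for s using x1[OF that, of 0 0] by simp
    then have "x \<in> perp n ?I" using xc by (simp add: perp_def)
    then have "A *\<^sub>v x = 0\<^sub>v n" using perp_mat_im[OF A] by simp
    moreover have "u \<bullet> x = 0" using x1[OF subspD(2)[OF I], of 1 0] xc by simp
    moreover have "v \<bullet> x = 0" using x1[OF subspD(2)[OF I], of 0 1] xc by simp
    ultimately show "x \<in> {x \<in> carrier_vec n. ?M *\<^sub>v x = 0\<^sub>v n}"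
      using xc minus_wedge_mult[OF C u(1) v(1) xc] u v by auto
  next
    fix x assume "x \<in> {x \<in> carrier_vec n. ?M *\<^sub>v x = 0\<^sub>v n}"
    then have x: "x \<in> carrier_vec n" and z: "A *\<^sub>v x - ((v \<bullet> x) \<cdot>\<^sub>v u - (u \<bullet> x) \<cdot>\<^sub>v v) = 0\<^sub>v n"
      using minus_wedge_mult[OF C u(1) v(1)] by auto
    have e: "(A *\<^sub>v x) $ i = (v \<bullet> x) * u $ i - (u \<bullet> x) * v $ i" if "i < n" for i
      using arg_cong[OF z, of "\<lambda>w. w $ i"] that u v C by auto
    have Ax: "c \<cdot>\<^sub>v (A *\<^sub>v x) \<in> ?I" for c
      using subspD(4)[OF I] x by (auto simp: mat_im_def)
    have ux: "u \<bullet> x = 0"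
    proof (rule ccontr)
      assume n: "u \<bullet> x \<noteq> 0"
      have "v = (- inverse (u \<bullet> x)) \<cdot>\<^sub>v (A *\<^sub>v x) + ((v \<bullet> x) / (u \<bullet> x)) \<cdot>\<^sub>v u"
        using n u v C e x by (intro eq_vecI) (auto simp: field_simps)
      then have "v \<in> adjoin ?I u" using adjoinI[OF Ax] by metis
      then show False using v by simp
    qed
    have vx: "v \<bullet> x = 0"
    proof (rule ccontr)
      assume n: "v \<bullet> x \<noteq> 0"
      have "u = inverse (v \<bullet> x) \<cdot>\<^sub>v (A *\<^sub>v x)"
        using n u v C e x ux by (intro eq_vecI) (auto simp: field_simps)
      then show False using Ax u by metis
    qed
    have "A *\<^sub>v x = 0\<^sub>v n" using e ux vx C by (intro eq_vecI) auto
    then have "x \<in> perp n ?I" using perp_mat_im[OF A] x by simp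
    then show "x \<in> perp n ?J"
      using ux vx x u v subspD(1)[OF I]
      by (auto simp: perp_def adjoin_def add_scalar_prod_distrib[of _ n])
  qed
  then have "perp n (perp n (mat_im n ?M)) = perp n (perp n ?J)"
    using perp_mat_im[OF M] by simp
  then show ?thesis
    using perp_perp[OF subsp_mat_im[OF alt_forms_carrier[OF M]]] perp_perp[OF J] by simp
qed

lemma rank_raise:
  fixes A :: "'a :: {field, finite} mat"
  assumes A: "A \<in> alt_forms n" and uv: "(u, v) \<in> raise_pairs n A"
  shows "vec_space.rank n (A - wedge n u v) = vec_space.rank n A + 2"
proof -
  have uv': "u \<in> carrier_vec n" "u \<notin> mat_im n A" "v \<in> carrier_vec n" "v \<notin> adjoin (mat_im n A) u"
    using uv by (auto simp: raise_pairs_def)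
  note I = subsp_mat_im[OF alt_forms_carrier[OF A]]
  have "card (mat_im n (A - wedge n u v)) = CARD('a) * (CARD('a) * card (mat_im n A))"
    unfolding mat_im_raise[OF A uv]
    using card_adjoin[OF subsp_adjoin[OF I uv'(1)] uv'(3,4)] card_adjoin[OF I uv'(1,2)] by simp
  then have "CARD('a) ^ vec_space.rank n (A - wedge n u v) = CARD('a) ^ (vec_space.rank n A + 2)"
    using card_mat_im[OF alt_forms_carrier[OF A]]
      card_mat_im[OF alt_forms_carrier[OF minus_alt[OF A wedge_alt]]] by simp
  moreover have "1 < CARD('a)" using card_field_ge_2[where 'a='a] by simp
  ultimately show ?thesis using power_inject_exp by blast
qed

text \<open>With \<open>u = A a\<close> and \<open>v = A b\<close>, both \<open>a\<close> and
  \<open>b\<close> lie in the kernel of \<open>?M\<close> and so are orthogonal to its image.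
  Pairing with them shows that \<open>(- u, v)\<close> is a raising pair for \<open>?M\<close>, and
  \<open>rank_raise\<close> leads back to \<open>A\<close>.\<close>

lemma rank_lower:
  fixes A :: "'a :: {field, finite} mat"
  assumes A: "A \<in> alt_forms n" and uv: "(u, v) \<in> lower_pairs n A"
  shows "vec_space.rank n A = vec_space.rank n (A - wedge n u v) + 2"
proof -
  let ?M = "A - wedge n u v"
  note C = alt_forms_carrier[OF A]
  obtain a b where a: "a \<in> carrier_vec n" "A *\<^sub>v a = u" "a \<bullet> v = 1"
    and b: "b \<in> carrier_vec n" "A *\<^sub>v b = v"
    using uv by (auto simp: lower_pairs_def mat_im_def)
  have u: "u \<in> carrier_vec n" and v: "v \<in> carrier_vec n" using a b C by auto
  have M: "?M \<in> alt_forms n" using A wedge_alt by (rule minus_alt)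
  have av: "v \<bullet> a = 1" using a v by (simp add: comm_scalar_prod[of _ n])
  have au: "a \<bullet> u = 0" "u \<bullet> a = 0"
    using scalar_prod_mult_alt(2)[OF A a(1) a(1)] a u by (simp_all add: comm_scalar_prod[of _ n])
  have bv: "v \<bullet> b = 0"
    using scalar_prod_mult_alt(2)[OF A b(1) b(1)] b v by (simp add: comm_scalar_prod[of _ n])
  have bu: "u \<bullet> b = - 1" "b \<bullet> u = - 1"
    using scalar_prod_mult_alt(1)[OF A b(1) a(1)] a b av u v by (simp_all add: comm_scalar_prod[of _ n])
  have "?M *\<^sub>v a = 0\<^sub>v n"
    using minus_wedge_mult[OF C u v a(1)] a av au u v by (intro eq_vecI) auto
  then have aM: "a \<in> perp n (mat_im n ?M)" using perp_mat_im[OF M] a by simp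
  have "?M *\<^sub>v b = 0\<^sub>v n"
    using minus_wedge_mult[OF C u v b(1)] b bv bu u v by (intro eq_vecI) auto
  then have bM: "b \<in> perp n (mat_im n ?M)" using perp_mat_im[OF M] b by simp
  have "- u \<notin> mat_im n ?M"
    using bM bu u b by (auto simp: perp_def)
  moreover have "v \<notin> adjoin (mat_im n ?M) (- u)"
  proof
    assume "v \<in> adjoin (mat_im n ?M) (- u)"
    then obtain s c where s: "s \<in> mat_im n ?M" "v = s + c \<cdot>\<^sub>v (- u)" by (auto simp: adjoin_def)
    have "s \<bullet> a = 0" using aM s by (simp add: perp_def)
    moreover have "s \<in> carrier_vec n"
      using subspD(1)[OF subsp_mat_im[OF alt_forms_carrier[OF M]] s(1)] .
    ultimately have "v \<bullet> a = 0"
      using s(2) u a au by (simp add: add_scalar_prod_distrib[of _ n])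
    then show False using av by simp
  qed
  ultimately have "(- u, v) \<in> raise_pairs n ?M" using u v by (auto simp: raise_pairs_def)
  from rank_raise[OF M this] show ?thesis using uminus_wedge[OF u C] by simp
qed

text \<open>A nonzero \<open>A\<close> always has a lowering pair: take \<open>A x\<close> nonzero
  and scale \<open>a\<close> so that \<open>a \<bullet> (A x) = 1\<close>. Each such pair removes 2
  from the rank.\<close>

lemma alt_rank_even:
  fixes A :: "'a :: {field, finite} mat"
  assumes "A \<in> alt_forms n"
  shows "even (vec_space.rank n A)"
  using assms
proof (induction "vec_space.rank n A" arbitrary: A rule: less_induct)
  case less
  note A = less.prems and C = alt_forms_carrier[OF less.prems]
  show ?case
  proof (cases "\<exists>x\<in>carrier_vec n. A *\<^sub>v x \<noteq> 0\<^sub>v n")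
    case False
    then have "mat_im n A \<subseteq> {0\<^sub>v n}" by (simp add: mat_im_def image_subset_iff)
    then have im: "mat_im n A = {0\<^sub>v n}" using subspD(2)[OF subsp_mat_im[OF C]] by blast
    have "CARD('a) ^ vec_space.rank n A = 1" unfolding card_mat_im[OF C, symmetric] im by simp
    moreover have "1 < CARD('a)" using card_field_ge_2[where 'a='a] by simp
    ultimately have "vec_space.rank n A = 0" using one_less_power by fastforce
    then show ?thesis by simp
  next
    case True
    then obtain x where x: "x \<in> carrier_vec n" "A *\<^sub>v x \<noteq> 0\<^sub>v n" by blast
    then obtain b where b: "b \<in> carrier_vec n" "b \<bullet> (A *\<^sub>v x) \<noteq> 0"
      using ex_scalar_prod_ne_0[of "A *\<^sub>v x" n] C by auto
    define a where "a = inverse (b \<bullet> (A *\<^sub>v x)) \<cdot>\<^sub>v b"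
    have "(A *\<^sub>v a, A *\<^sub>v x) \<in> lower_pairs n A"
      unfolding lower_pairs_def mat_im_def using x b C
      by (auto simp: a_def intro!: bexI[of _ a])
    from rank_lower[OF A this] less.hyps[of "A - wedge n (A *\<^sub>v a) (A *\<^sub>v x)"] minus_alt[OF A wedge_alt]
    show ?thesis by simp
  qed
qed

text \<open>Modulo the image of \<open>A\<close> the vectors \<open>u\<close> and \<open>v\<close>
  are dependent, so the image grows by at most one dimension, and parity excludes a growth of
  exactly 1.\<close>

lemma rank_minus_wedge_le:
  fixes A :: "'a :: {field, finite} mat"
  assumes A: "A \<in> alt_forms n" and uv: "u \<in> carrier_vec n" "v \<in> carrier_vec n" "(u, v) \<notin> raise_pairs n A"
  shows "vec_space.rank n (A - wedge n u v) \<le> vec_space.rank n A"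
proof -
  let ?M = "A - wedge n u v" and ?I = "mat_im n A"
  note C = alt_forms_carrier[OF A]
  have M: "?M \<in> alt_forms n" using A wedge_alt by (rule minus_alt)
  have I: "subsp n ?I" using C by (rule subsp_mat_im)
  note D = subspD[OF I]
  have "\<exists>w\<in>carrier_vec n. mat_im n ?M \<subseteq> adjoin ?I w"
  proof (cases "u \<in> ?I")
    case True
    have "?M *\<^sub>v x \<in> adjoin ?I v" if x: "x \<in> carrier_vec n" for x
    proof -
      have "?M *\<^sub>v x = (A *\<^sub>v x - (v \<bullet> x) \<cdot>\<^sub>v u) + (u \<bullet> x) \<cdot>\<^sub>v v"
        unfolding minus_wedge_mult[OF C uv(1,2) x] using C uv x by (intro eq_vecI) auto
      moreover have "A *\<^sub>v x - (v \<bullet> x) \<cdot>\<^sub>v u \<in> ?I"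
        by (rule D(5)[OF _ D(4)[OF True]]) (use x in \<open>simp add: mat_im_def\<close>)
      ultimately show ?thesis by (simp only: adjoinI)
    qed
    then show ?thesis using uv by (intro bexI[of _ v]) (auto simp: mat_im_def)
  next
    case False
    then obtain s c where s: "s \<in> ?I" "v = s + c \<cdot>\<^sub>v u"
      using uv by (auto simp: raise_pairs_def adjoin_def)
    have "?M *\<^sub>v x \<in> adjoin ?I u" if x: "x \<in> carrier_vec n" for x
    proof -
      have "?M *\<^sub>v x = (A *\<^sub>v x + (u \<bullet> x) \<cdot>\<^sub>v s) + ((u \<bullet> x) * c - v \<bullet> x) \<cdot>\<^sub>v u"
        unfolding minus_wedge_mult[OF C uv(1,2) x] using C uv x s D(1)[OF s(1)]
        by (intro eq_vecI) (auto simp: algebra_simps)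
      moreover have "A *\<^sub>v x + (u \<bullet> x) \<cdot>\<^sub>v s \<in> ?I"
        by (rule D(3)[OF _ D(4)[OF s(1)]]) (use x in \<open>simp add: mat_im_def\<close>)
      ultimately show ?thesis by (simp only: adjoinI)
    qed
    then show ?thesis using uv by (intro bexI[of _ u]) (auto simp: mat_im_def)
  qed
  then obtain w where w: "w \<in> carrier_vec n" "mat_im n ?M \<subseteq> adjoin ?I w" by blast
  have "card (mat_im n ?M) \<le> card (adjoin ?I w)"
    using w subsp_finite[OF subsp_adjoin[OF I w(1)]] by (intro card_mono)
  also have "\<dots> \<le> card (?I \<times> (UNIV :: 'a set))"
    unfolding adjoin_def using subsp_finite[OF I] by (intro card_image_le) auto
  finally have "CARD('a) ^ vec_space.rank n ?M \<le> CARD('a) ^ (vec_space.rank n A + 1)"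
    using card_mat_im[OF C] card_mat_im[OF alt_forms_carrier[OF M]] by (simp add: card_cartesian_product mult.commute)
  moreover have "1 < CARD('a)" using card_field_ge_2[where 'a='a] by simp
  ultimately have "vec_space.rank n ?M \<le> vec_space.rank n A + 1"
    by (intro power_le_imp_le_exp)
  then show ?thesis
    using alt_rank_even[OF A] alt_rank_even[OF M] by presburger
qed

text \<open>If the rank dropped, \<open>(- u, v)\<close> would be a raising pair for
  \<open>?M\<close>, and from this \<open>(u, v)\<close> is shown to be a lowering pair for
  \<open>A\<close>.\<close>

lemma rank_keep:
  fixes A :: "'a :: {field, finite} mat"
  assumes A: "A \<in> alt_forms n" and uv: "u \<in> carrier_vec n" "v \<in> carrier_vec n"
    "(u, v) \<notin> raise_pairs n A" "(u, v) \<notin> lower_pairs n A"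
  shows "vec_space.rank n (A - wedge n u v) = vec_space.rank n A"
proof (rule antisym)
  show "vec_space.rank n (A - wedge n u v) \<le> vec_space.rank n A"
    using A uv(1-3) by (rule rank_minus_wedge_le)
  let ?M = "A - wedge n u v" 
  note C = alt_forms_carrier[OF A]
  have M: "?M \<in> alt_forms n" using A wedge_alt by (rule minus_alt)
  have e: "?M - wedge n (- u) v = A" using uv(1) C by (rule uminus_wedge)
  have u': "- u \<in> carrier_vec n" using uv by simp
  show "vec_space.rank n A \<le> vec_space.rank n ?M"
  proof (cases "(- u, v) \<in> raise_pairs n ?M")
    case False
    then show ?thesis using rank_minus_wedge_le[OF M u' uv(2)] e by simp
  next
    case True
    note I = subsp_mat_im[OF alt_forms_carrier[OF M]]
    have im: "mat_im n A = adjoin (adjoin (mat_im n ?M) (- u)) v"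
      using mat_im_raise[OF M True] e by simp
    have "v = (0\<^sub>v n + 0 \<cdot>\<^sub>v (- u)) + 1 \<cdot>\<^sub>v v" using uv by (intro eq_vecI) auto
    then have vI: "v \<in> mat_im n A"
      unfolding im using adjoinI[OF adjoinI[OF subspD(2)[OF I]]] by metis
    \<comment> \<open>The subspace equals its double complement and does not contain
      \<open>v\<close>, so some \<open>x\<close> is orthogonal to it but not to \<open>v\<close>.
      Scaled, this \<open>x\<close> is the preimage of \<open>u\<close> that
      \<open>lower_pairs\<close> asks for.\<close>
    have "v \<notin> perp n (perp n (adjoin (mat_im n ?M) (- u)))"
      using True perp_perp[OF subsp_adjoin[OF I u']] by (simp add: raise_pairs_def)
    then obtain x where x: "x \<in> perp n (adjoin (mat_im n ?M) (- u))" "x \<bullet> v \<noteq> 0"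
      using uv by (auto simp: perp_def)
    have xc: "x \<in> carrier_vec n" and x0: "\<And>s c. s \<in> mat_im n ?M \<Longrightarrow> (s + c \<cdot>\<^sub>v (- u)) \<bullet> x = 0"
      using x by (auto simp: perp_def adjoin_def)
    have x1: "s \<bullet> x - c * (u \<bullet> x) = 0" if "s \<in> mat_im n ?M" for s c
      using x0[OF that, of c] subspD(1)[OF I that] uv xc by (simp add: add_scalar_prod_distrib[of _ n])
    have ux: "u \<bullet> x = 0" using x1[OF subspD(2)[OF I], of 1] xc by simp
    have "s \<bullet> x = 0" if "s \<in> mat_im n ?M" for s using x1[OF that, of 0] by simp
    then have "x \<in> perp n (mat_im n ?M)" using xc by (simp add: perp_def)
    then have Mx: "A *\<^sub>v x - ((v \<bullet> x) \<cdot>\<^sub>v u - (u \<bullet> x) \<cdot>\<^sub>v v) = 0\<^sub>v n"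
      using perp_mat_im[OF M] minus_wedge_mult[OF C uv(1,2) xc] by simp
    have vx: "v \<bullet> x = x \<bullet> v" using uv xc by (intro comm_scalar_prod)
    have Ax: "A *\<^sub>v x = (x \<bullet> v) \<cdot>\<^sub>v u"
    proof (rule eq_vecI)
      fix i assume "i < dim_vec ((x \<bullet> v) \<cdot>\<^sub>v u)"
      then show "(A *\<^sub>v x) $ i = ((x \<bullet> v) \<cdot>\<^sub>v u) $ i"
        using arg_cong[OF Mx, of "\<lambda>w. w $ i"] C uv ux vx by auto
    qed (use C uv in auto)
    define a where "a = inverse (x \<bullet> v) \<cdot>\<^sub>v x"
    have "A *\<^sub>v a = u"
      unfolding a_def mult_mat_vec[OF C xc] Ax using x(2) uv by (intro eq_vecI) auto
    moreover have "a \<bullet> v = 1" using x(2) xc uv by (simp add: a_def)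
    moreover have "a \<in> carrier_vec n" using xc by (simp add: a_def)
    ultimately have "(u, v) \<in> lower_pairs n A" using vI by (auto simp: lower_pairs_def)
    then show ?thesis using uv(4) by simp
  qed
qed

subsection \<open>Counting rank changes\<close>

lemma raise_pairs_subset: "raise_pairs n A \<subseteq> carrier_vec n \<times> carrier_vec n"
  by (auto simp: raise_pairs_def)

lemma lower_pairs_subset:
  assumes "A \<in> carrier_mat n n"
  shows "lower_pairs n A \<subseteq> mat_im n A \<times> mat_im n A" "mat_im n A \<subseteq> carrier_vec n"
  using assms by (auto simp: lower_pairs_def mat_im_def)

lemma raise_lower_disjoint: "raise_pairs n A \<inter> lower_pairs n A = {}"
  by (auto simp: raise_pairs_def lower_pairs_def mat_im_def)

text \<open>\<open>u\<close> avoids the image, and then \<open>v\<close> avoids a space larger by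
  one dimension. At full rank the first factor is 0, so the negative second factor does no
  harm.\<close>

lemma card_raise_pairs:
  fixes A :: "'a :: {field, finite} mat"
  assumes A: "A \<in> alt_forms n"
  shows "(of_nat (card (raise_pairs n A)) :: complex) =
    (of_nat CARD('a) ^ n - of_nat CARD('a) ^ vec_space.rank n A) *
    (of_nat CARD('a) ^ n - of_nat CARD('a) ^ (vec_space.rank n A + 1))"
proof -
  let ?V = "carrier_vec n :: 'a vec set" and ?I = "mat_im n A"
  note C = alt_forms_carrier[OF A]
  have I: "subsp n ?I" using C by (rule subsp_mat_im)
  have IV: "?I \<subseteq> ?V" using lower_pairs_subset(2)[OF C] .
  have cI: "card ?I = CARD('a) ^ vec_space.rank n A" using C by (rule card_mat_im)
  have eq: "raise_pairs n A = Sigma (?V - ?I) (\<lambda>u. ?V - adjoin ?I u)"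
    by (auto simp: raise_pairs_def)
  have c: "(of_nat (card (?V - adjoin ?I u)) :: complex) =
      of_nat CARD('a) ^ n - of_nat CARD('a) ^ (vec_space.rank n A + 1)" if u: "u \<in> ?V - ?I" for u
  proof -
    have J: "subsp n (adjoin ?I u)" using I u by (intro subsp_adjoin) auto
    then have JV: "adjoin ?I u \<subseteq> ?V" by (simp add: subsp_def)
    have cJ: "card (adjoin ?I u) = CARD('a) ^ (vec_space.rank n A + 1)"
      using card_adjoin[OF I, of u] u cI by simp
    have "card (?V - adjoin ?I u) = card ?V - card (adjoin ?I u)"
      using subsp_finite[OF J] JV by (rule card_Diff_subset)
    moreover have "card (adjoin ?I u) \<le> card ?V" using JV by (intro card_mono) auto
    ultimately have "(of_nat (card (?V - adjoin ?I u)) :: complex) =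
        of_nat (card ?V) - of_nat (card (adjoin ?I u))" by (simp add: of_nat_diff)
    then show ?thesis unfolding cJ card_carrier_vec of_nat_power .
  qed
  have "card (?V - ?I) = card ?V - card ?I"
    using subsp_finite[OF I] IV by (rule card_Diff_subset)
  moreover have "card ?I \<le> card ?V" using IV by (intro card_mono) auto
  ultimately have c2: "(of_nat (card (?V - ?I)) :: complex) =
      of_nat CARD('a) ^ n - of_nat CARD('a) ^ vec_space.rank n A"
    by (simp add: of_nat_diff cI card_carrier_vec)
  have "(of_nat (card (raise_pairs n A)) :: complex) = (\<Sum>u\<in>?V - ?I. of_nat (card (?V - adjoin ?I u)))"
    unfolding eq by (subst card_SigmaI) auto
  also have "\<dots> = (\<Sum>u\<in>?V - ?I. of_nat CARD('a) ^ n - of_nat CARD('a) ^ (vec_space.rank n A + 1))"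
    using c by (rule sum.cong[OF refl])
  finally show ?thesis unfolding sum_constant c2 .
qed

text \<open>For nonzero \<open>u\<close> in the image with preimage \<open>w u\<close>, the form
  \<open>v \<bullet> w u\<close> does not vanish on the image, so it takes the value 1 on the
  fraction \<open>1 / CARD('a)\<close> of it. The factor on the left avoids the exponent
  \<open>rank - 1\<close>, which would be truncated at rank 0.\<close>

lemma card_lower_pairs:
  fixes A :: "'a :: {field, finite} mat"
  assumes A: "A \<in> alt_forms n"
  shows "(of_nat CARD('a) :: complex) * of_nat (card (lower_pairs n A)) =
    (of_nat CARD('a) ^ vec_space.rank n A - 1) * of_nat CARD('a) ^ vec_space.rank n A"
proof -
  let ?I = "mat_im n A"
  note C = alt_forms_carrier[OF A]
  have I: "subsp n ?I" using C by (rule subsp_mat_im)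
  note D = subspD[OF I]
  have fI: "finite ?I" using I by (rule subsp_finite)
  have cI: "card ?I = CARD('a) ^ vec_space.rank n A" using C by (rule card_mat_im)
  define w where "w u = (SOME a. a \<in> carrier_vec n \<and> A *\<^sub>v a = u)" for u
  have w: "w u \<in> carrier_vec n" "A *\<^sub>v w u = u" if "u \<in> ?I" for u
  proof -
    have "\<exists>a. a \<in> carrier_vec n \<and> A *\<^sub>v a = u" using that by (auto simp: mat_im_def)
    from someI_ex[OF this] show "w u \<in> carrier_vec n" "A *\<^sub>v w u = u" by (simp_all add: w_def)
  qed
  have indep: "a \<bullet> v = - (u \<bullet> b)"
    if "a \<in> carrier_vec n" "A *\<^sub>v a = u" "b \<in> carrier_vec n" "A *\<^sub>v b = v" for a b u v
    using scalar_prod_mult_alt(1)[OF A that(1,3)] that by simp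
  have eq: "lower_pairs n A = Sigma (?I - {0\<^sub>v n}) (\<lambda>u. {v\<in>?I. v \<bullet> w u = 1})"
  proof (intro equalityI subsetI)
    fix p assume "p \<in> lower_pairs n A"
    moreover obtain u v where p: "p = (u, v)" by (cases p)
    ultimately have uv: "(u, v) \<in> lower_pairs n A" by simp
    then obtain a where a: "a \<in> carrier_vec n" "A *\<^sub>v a = u" "a \<bullet> v = 1" and v: "v \<in> ?I"
      by (auto simp: lower_pairs_def)
    obtain b where b: "b \<in> carrier_vec n" "A *\<^sub>v b = v" using v by (auto simp: mat_im_def)
    have u: "u \<in> ?I" using a by (auto simp: mat_im_def)
    have "u \<noteq> 0\<^sub>v n" using indep[OF a(1,2) b] a(3) b(1) by auto
    moreover have "w u \<bullet> v = 1" using indep[OF a(1,2) b] indep[OF w[OF u] b] a(3) by simp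
    then have "v \<bullet> w u = 1" using D(1)[OF v] w(1)[OF u] by (simp add: comm_scalar_prod[of _ n])
    ultimately show "p \<in> Sigma (?I - {0\<^sub>v n}) (\<lambda>u. {v\<in>?I. v \<bullet> w u = 1})" using u v by (simp add: p)
  next
    fix p assume "p \<in> Sigma (?I - {0\<^sub>v n}) (\<lambda>u. {v\<in>?I. v \<bullet> w u = 1})"
    then obtain u v where p: "p = (u, v)" and u: "u \<in> ?I" and v: "v \<in> ?I" "v \<bullet> w u = 1" by auto
    then have "w u \<bullet> v = 1" using D(1)[OF v(1)] w(1)[OF u] by (simp add: comm_scalar_prod[of _ n])
    then show "p \<in> lower_pairs n A" using w[OF u] v by (auto simp: lower_pairs_def p)
  qed
  have c: "CARD('a) * card {v\<in>?I. v \<bullet> w u = 1} = card ?I" if u: "u \<in> ?I - {0\<^sub>v n}" for u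
  proof -
    have wu: "w u \<in> carrier_vec n" "A *\<^sub>v w u = u" using w u by auto
    have "w u \<notin> perp n ?I" using perp_mat_im[OF A] wu u by auto
    then obtain x where "x \<in> ?I" "x \<bullet> w u \<noteq> 0" using wu by (auto simp: perp_def)
    then show ?thesis using card_fibre[OF I wu(1)] by blast
  qed
  have "CARD('a) * card (lower_pairs n A) = (\<Sum>u\<in>?I - {0\<^sub>v n}. CARD('a) * card {v\<in>?I. v \<bullet> w u = 1})"
    unfolding eq using fI by (subst card_SigmaI) (auto simp: sum_distrib_left)
  also have "\<dots> = (\<Sum>u\<in>?I - {0\<^sub>v n}. card ?I)" using c by (rule sum.cong[OF refl])
  also have "\<dots> = (card ?I - 1) * card ?I" using D(2) by simp
  finally have "(of_nat (CARD('a) * card (lower_pairs n A)) :: complex) = of_nat ((card ?I - 1) * card ?I)"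
    by (rule arg_cong)
  moreover have "card ?I \<ge> 1" unfolding cI by simp
  ultimately show ?thesis by (simp add: of_nat_diff cI)
qed

text \<open>At rank 0 the argument \<open>r - 2\<close> is truncated, but there are no lowering
  pairs then and its weight is 0; rank 1 does not occur.\<close>

lemma sum_rank_wedge:
  fixes A :: "'a :: {field, finite} mat" and F :: "nat \<Rightarrow> complex"
  assumes A: "A \<in> alt_forms n"
  defines "r \<equiv> vec_space.rank n A"
    and "a \<equiv> of_nat (card (raise_pairs n A))" and "b \<equiv> of_nat (card (lower_pairs n A))"
  shows "(\<Sum>(u, v)\<in>carrier_vec n \<times> carrier_vec n. F (vec_space.rank n (A - wedge n u v))) =
    a * F (r + 2) + b * F (r - 2) + (of_nat CARD('a) ^ (2 * n) - a - b) * F r"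
proof -
  let ?W = "carrier_vec n \<times> carrier_vec n :: ('a vec \<times> 'a vec) set"
  let ?R = "raise_pairs n A" and ?L = "lower_pairs n A"
  let ?f = "\<lambda>(u, v). F (vec_space.rank n (A - wedge n u v))"
  note C = alt_forms_carrier[OF A]
  have R: "?R \<subseteq> ?W" by (rule raise_pairs_subset)
  have L: "?L \<subseteq> ?W - ?R"
    using lower_pairs_subset[OF C] raise_lower_disjoint[of n A] by blast
  have fin: "finite ?W" by simp
  have cW: "card ?W = CARD('a) ^ (2 * n)"
    by (simp add: card_cartesian_product card_carrier_vec power_add[symmetric] mult_2)
  have "sum ?f ?W = sum ?f (?W - ?R - ?L) + sum ?f ?L + sum ?f ?R"
    using sum.subset_diff[OF R fin, of ?f] sum.subset_diff[OF L _, of ?f] fin by simp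
  also have "sum ?f ?R = (\<Sum>p\<in>?R. F (r + 2))"
    using rank_raise[OF A] by (intro sum.cong) (auto simp: r_def)
  also have "sum ?f ?L = (\<Sum>p\<in>?L. F (r - 2))"
  proof (rule sum.cong[OF refl])
    fix p assume p: "p \<in> ?L"
    obtain u v where uv: "p = (u, v)" by (cases p)
    show "?f p = F (r - 2)" using rank_lower[OF A p[unfolded uv]] by (simp add: uv r_def)
  qed
  also have "sum ?f (?W - ?R - ?L) = (\<Sum>p\<in>?W - ?R - ?L. F r)"
    using rank_keep[OF A] by (intro sum.cong) (auto simp: r_def)
  also have "\<dots> = (of_nat CARD('a) ^ (2 * n) - a - b) * F r"
  proof -
    have "card (?W - ?R - ?L) = card ?W - card ?R - card ?L"
      using R L fin finite_subset[OF R fin] finite_subset[OF L]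
      by (simp add: card_Diff_subset)
    moreover have "card ?R \<le> card ?W" using fin R by (rule card_mono)
    moreover have "card ?L \<le> card ?W - card ?R"
      using card_mono[OF _ L] fin finite_subset[OF R fin] R by (simp add: card_Diff_subset)
    ultimately have "(of_nat (card (?W - ?R - ?L)) :: complex) = of_nat (card ?W) - a - b"
      by (simp add: of_nat_diff a_def b_def)
    then show ?thesis by (simp add: cW)
  qed
  finally show ?thesis by (simp add: a_def b_def algebra_simps)
qed

section \<open>Representing a given matrix as a wedge\<close>

lemma rank_0_eq_zero:
  fixes A :: "'a :: {field, finite} mat"
  assumes A: "A \<in> carrier_mat n n" and r: "vec_space.rank n A = 0"
  shows "A = 0\<^sub>m n n"
proof -
  have "card (mat_im n A) = 1" using card_mat_im[OF A] r by simp
  then obtain z where z: "mat_im n A = {z}" by (rule card_1_singletonE)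
  moreover have "0\<^sub>v n \<in> mat_im n A" using subspD(2)[OF subsp_mat_im[OF A]] .
  ultimately have im: "mat_im n A = {0\<^sub>v n}" by simp
  show ?thesis
  proof (rule eq_matI)
    fix i j assume "i < dim_row (0\<^sub>m n n :: 'a mat)" "j < dim_col (0\<^sub>m n n :: 'a mat)"
    then have ij: "i < n" "j < n" by auto
    have "A *\<^sub>v unit_vec n j \<in> mat_im n A" by (simp add: mat_im_def)
    then have "(A *\<^sub>v unit_vec n j) $ i = 0" using im ij by simp
    then show "A $$ (i, j) = 0\<^sub>m n n $$ (i, j)" using ij A by simp
  qed (use A in auto)
qed

lemma rank_zero: "vec_space.rank n (0\<^sub>m n n :: 'a :: field mat) = 0"
  by (rule vec_space.rank_0I)

lemma finite_alt_forms: "finite (alt_forms n :: 'a :: {field, finite} mat set)"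
proof (rule finite_subset)
  show "alt_forms n \<subseteq> mat_of_rows n ` {xs :: 'a vec list. set xs \<subseteq> carrier_vec n \<and> length xs = n}"
  proof
    fix A :: "'a mat" assume "A \<in> alt_forms n"
    then have A: "A \<in> carrier_mat n n" by (rule alt_forms_carrier)
    then have "A = mat_of_rows n (rows A)" by (metis carrier_matD(2) mat_of_rows_rows)
    moreover have "set (rows A) \<subseteq> carrier_vec n" using A rows_carrier by fastforce
    moreover have "length (rows A) = n" using A by simp
    ultimately show "A \<in> mat_of_rows n ` {xs. set xs \<subseteq> carrier_vec n \<and> length xs = n}" by blast
  qed
  show "finite (mat_of_rows n ` {xs :: 'a vec list. set xs \<subseteq> carrier_vec n \<and> length xs = n})"
    by (intro finite_imageI finite_lists_length_eq) simp
qed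

text \<open>Evaluates \<open>sum_rank_wedge\<close> at the indicator of rank 0, since
  \<open>wedge n u v = C\<close> exactly when the difference has rank 0. Thus a matrix of rank 2 is
  represented by its lowering pairs, and 0 by the pairs that are not raising pairs.\<close>

lemma card_wedge_fibre:
  fixes C :: "'a :: {field, finite} mat"
  assumes C: "C \<in> alt_forms n"
  defines "N \<equiv> card {(u, v) \<in> carrier_vec n \<times> carrier_vec n. wedge n u v = C}"
  shows "vec_space.rank n C = 0 \<Longrightarrow> (of_nat N :: complex) = of_nat CARD('a) ^ (2 * n) -
      (of_nat CARD('a) ^ n - 1) * (of_nat CARD('a) ^ n - of_nat CARD('a))"
    and "vec_space.rank n C = 2 \<Longrightarrow> (of_nat N :: complex) = of_nat CARD('a) * (of_nat CARD('a) ^ 2 - 1)"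
    and "vec_space.rank n C > 2 \<Longrightarrow> N = 0"
proof -
  let ?q = "of_nat CARD('a) :: complex" and ?r = "vec_space.rank n C"
  define F where "F k = (if k = 0 then 1 else 0 :: complex)" for k :: nat
  have CC: "C \<in> carrier_mat n n" using C by (rule alt_forms_carrier)
  have iff: "vec_space.rank n (C - wedge n u v) = 0 \<longleftrightarrow> wedge n u v = C" for u v
  proof
    assume 0: "vec_space.rank n (C - wedge n u v) = 0"
    have "C - wedge n u v = 0\<^sub>m n n"
      using alt_forms_carrier[OF minus_alt[OF C wedge_alt]] 0 by (rule rank_0_eq_zero)
    then have e: "(C - wedge n u v) $$ (i, j) = 0" if "i < n" "j < n" for i j using that by simp
    show "wedge n u v = C"
    proof (rule eq_matI)
      fix i j assume "i < dim_row C" "j < dim_col C"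
      then show "wedge n u v $$ (i, j) = C $$ (i, j)"
        using e[of i j] CC alt_forms_carrier[OF wedge_alt[of n u v]] by auto
    qed (use CC alt_forms_carrier[OF wedge_alt[of n u v]] in auto)
  next
    assume "wedge n u v = C"
    then show "vec_space.rank n (C - wedge n u v) = 0"
      using minus_r_inv_mat[OF CC] rank_zero by metis
  qed
  let ?W = "carrier_vec n \<times> carrier_vec n :: ('a vec \<times> 'a vec) set"
  let ?B = "{(u, v) \<in> ?W. wedge n u v = C}"
  have "(\<Sum>(u, v)\<in>?W. F (vec_space.rank n (C - wedge n u v))) = (\<Sum>p\<in>?W. if p \<in> ?B then 1 else 0)"
  proof (rule sum.cong[OF refl])
    fix p assume p: "p \<in> ?W"
    obtain u v where uv: "p = (u, v)" by (cases p)
    show "(case p of (u, v) \<Rightarrow> F (vec_space.rank n (C - wedge n u v))) = (if p \<in> ?B then 1 else 0)"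
      using p iff[of u v] unfolding uv F_def by simp
  qed
  also have "\<dots> = (\<Sum>p\<in>?W \<inter> ?B. 1)" by (rule sum.inter_restrict[symmetric]) simp
  also have "?W \<inter> ?B = ?B" by blast
  finally have "of_nat N = (\<Sum>(u, v)\<in>?W. F (vec_space.rank n (C - wedge n u v)))"
    by (simp add: N_def)
  note * = this[unfolded sum_rank_wedge[OF C]]
  have q0: "?q \<noteq> 0" by simp
  show "?r = 0 \<Longrightarrow> of_nat N = ?q ^ (2 * n) - (?q ^ n - 1) * (?q ^ n - ?q)"
  proof -
    assume r: "?r = 0"
    have "of_nat (card (lower_pairs n C)) = (0 :: complex)"
      using card_lower_pairs[OF C] q0 r by simp
    then show ?thesis using * r card_raise_pairs[OF C] by (simp add: F_def)
  qed
  show "of_nat N = ?q * (?q ^ 2 - 1)" if r: "?r = 2"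
  proof -
    have "?q * of_nat (card (lower_pairs n C)) = ?q * (?q * (?q ^ 2 - 1))"
      using card_lower_pairs[OF C] r by (simp add: power2_eq_square algebra_simps)
    then have "of_nat (card (lower_pairs n C)) = ?q * (?q ^ 2 - 1)" using q0 by simp
    then show ?thesis using * r by (simp add: F_def)
  qed
  show "N = 0" if r: "?r > 2" using * r by (simp add: F_def)
qed

text \<open>Groups the pairs by the matrix they represent; only 0 and matrices of rank 2 occur. The
  translation sum thereby becomes a combination of the identity and the adjacency operator of class
  1.\<close>

lemma sum_wedge:
  fixes A :: "'a :: {field, finite} mat" and F :: "'a mat \<Rightarrow> complex"
  assumes A: "A \<in> alt_forms n"
  defines "q \<equiv> of_nat CARD('a) :: complex"
  shows "(\<Sum>(u, v)\<in>carrier_vec n \<times> carrier_vec n. F (A - wedge n u v)) =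
    q * (q ^ 2 - 1) * (\<Sum>Y | Y \<in> alt_forms n \<and> vec_space.rank n (A - Y) = 2. F Y)
    + (q ^ (2 * n) - (q ^ n - 1) * (q ^ n - q)) * F A"
proof -
  let ?W = "carrier_vec n \<times> carrier_vec n :: ('a vec \<times> 'a vec) set"
  let ?X = "alt_forms n :: 'a mat set"
  let ?N = "\<lambda>C. card {(u, v) \<in> ?W. wedge n u v = C}"
  let ?m = "q * (q ^ 2 - 1)" and ?z = "q ^ (2 * n) - (q ^ n - 1) * (q ^ n - q)"
  let ?S = "{C \<in> ?X. vec_space.rank n C = 2}" and ?Z = "0\<^sub>m n n :: 'a mat"
  have CA: "A \<in> carrier_mat n n" using A by (rule alt_forms_carrier)
  have "(\<Sum>(u, v)\<in>?W. F (A - wedge n u v)) =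
      (\<Sum>C\<in>?X. \<Sum>p | p \<in> ?W \<and> (case p of (u, v) \<Rightarrow> wedge n u v) = C. (case p of (u, v) \<Rightarrow> F (A - wedge n u v)))"
    using finite_alt_forms[of n, where 'a='a] wedge_alt
    by (intro sum.group[symmetric]) auto
  also have "\<dots> = (\<Sum>C\<in>?X. of_nat (?N C) * F (A - C))"
  proof (rule sum.cong[OF refl])
    fix C :: "'a mat"
    let ?B = "{(u, v) \<in> ?W. wedge n u v = C}"
    have B: "{p. p \<in> ?W \<and> (case p of (u, v) \<Rightarrow> wedge n u v) = C} = ?B" by auto
    have "(\<Sum>p\<in>?B. (case p of (u, v) \<Rightarrow> F (A - wedge n u v))) = (\<Sum>p\<in>?B. F (A - C))"
      by (rule sum.cong[OF refl]) auto
    then show "(\<Sum>p | p \<in> ?W \<and> (case p of (u, v) \<Rightarrow> wedge n u v) = C. (case p of (u, v) \<Rightarrow> F (A - wedge n u v))) =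
        of_nat (?N C) * F (A - C)" unfolding B by (simp only: sum_constant)
  qed
  also have "\<dots> = (\<Sum>C\<in>insert ?Z ?S. of_nat (?N C) * F (A - C))"
  proof (rule sum.mono_neutral_right)
    show "finite ?X" by (rule finite_alt_forms)
    show "insert ?Z ?S \<subseteq> ?X" using zero_alt by auto
    show "\<forall>C\<in>?X - insert ?Z ?S. of_nat (?N C) * F (A - C) = 0"
    proof
      fix C assume C: "C \<in> ?X - insert ?Z ?S"
      then have "vec_space.rank n C \<noteq> 0" using rank_0_eq_zero alt_forms_carrier by blast
      moreover have "vec_space.rank n C \<noteq> 2" "even (vec_space.rank n C)"
        using C alt_rank_even by auto
      ultimately have "vec_space.rank n C > 2" by presburger
      then show "of_nat (?N C) * F (A - C) = 0" using card_wedge_fibre(3)[of C n] C by simp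
    qed
  qed
  also have "\<dots> = (\<Sum>C\<in>?S. of_nat (?N C) * F (A - C)) + of_nat (?N ?Z) * F (A - ?Z)"
    using finite_subset[OF _ finite_alt_forms[of n, where 'a='a], of ?S]
    by (subst sum.insert) (auto simp: rank_zero)
  also have "of_nat (?N ?Z) = ?z" using card_wedge_fibre(1)[OF zero_alt rank_zero] by (simp add: q_def)
  also have "A - ?Z = A" using CA by (intro eq_matI) auto
  also have "(\<Sum>C\<in>?S. of_nat (?N C) * F (A - C)) = (\<Sum>C\<in>?S. ?m * F (A - C))"
    using card_wedge_fibre(2) by (intro sum.cong) (auto simp: q_def)
  also have "\<dots> = ?m * (\<Sum>C\<in>?S. F (A - C))" by (simp add: sum_distrib_left)
  also have "(\<Sum>C\<in>?S. F (A - C)) = (\<Sum>Y | Y \<in> ?X \<and> vec_space.rank n (A - Y) = 2. F Y)"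
  proof (rule sum.reindex_bij_witness[of _ "\<lambda>Y. A - Y" "\<lambda>C. A - C"])
    have AA: "A - (A - Y) = Y" if "Y \<in> ?X" for Y
      using CA alt_forms_carrier[OF that] by (intro eq_matI) auto
    show "A - (A - C) = C" "A - C \<in> {Y \<in> ?X. vec_space.rank n (A - Y) = 2}" if "C \<in> ?S" for C
      using that minus_alt[OF A, of C] AA[of C] by auto
    show "A - (A - Y) = Y" "A - Y \<in> ?S" if "Y \<in> {Y \<in> ?X. vec_space.rank n (A - Y) = 2}" for Y
      using that minus_alt[OF A, of Y] AA[of Y] by auto
  qed simp
  finally show ?thesis .
qed

subsection \<open>The eigenmatrix of the alternating forms scheme\<close>

lemma wedge_diff_right:
  assumes "A \<in> carrier_mat n n" "v \<in> carrier_vec n" "w \<in> carrier_vec n"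
  shows "A - wedge n u w - wedge n u v = A - wedge n u (v + w)"
  using assms by (intro eq_matI) (auto simp: wedge_def algebra_simps)

lemma wedge_zero_right:
  assumes "A \<in> carrier_mat n n"
  shows "A - wedge n u (0\<^sub>v n) = A"
  using assms by (intro eq_matI) (auto simp: wedge_def)

lemma sum_alt_forms_shift:
  fixes g :: "'a :: {field, finite} mat \<Rightarrow> complex"
  assumes v: "v \<in> carrier_vec n"
  shows "(\<Sum>A\<in>alt_forms n. g (A - wedge n u v)) = (\<Sum>A\<in>alt_forms n. g A)"
proof (rule sum.reindex_bij_witness[of _ "\<lambda>A. A - wedge n u (- v)" "\<lambda>A. A - wedge n u v"])
  fix A :: "'a mat" assume A: "A \<in> alt_forms n"
  note C = alt_forms_carrier[OF A]
  show "A - wedge n u v - wedge n u (- v) = A" "A - wedge n u (- v) - wedge n u v = A"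
    using v C by (simp_all add: wedge_diff_right wedge_zero_right)
  show "A - wedge n u v \<in> alt_forms n" "A - wedge n u (- v) \<in> alt_forms n"
    using minus_alt[OF A wedge_alt] by blast+
qed simp

text \<open>
  For fixed \<open>u\<close> the matrices \<open>wedge n u v\<close> form a subgroup, and averaging over its cosets is an
  orthogonal projection.
\<close>

lemma wedge_sum_eigenvalue_nonneg:
  fixes f :: "'a :: {field, finite} mat \<Rightarrow> complex"
  assumes eig: "\<And>A. A \<in> alt_forms n \<Longrightarrow>
      (\<Sum>(u, v)\<in>carrier_vec n \<times> carrier_vec n. f (A - wedge n u v)) = \<tau> * f A"
    and nz: "A0 \<in> alt_forms n" "f A0 \<noteq> 0"
  shows "\<exists>\<rho> \<ge> 0. \<tau> = complex_of_real \<rho>"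
proof -
  let ?X = "alt_forms n :: 'a mat set" and ?V = "carrier_vec n :: 'a vec set"
  define h where "h u A = (\<Sum>v\<in>?V. f (A - wedge n u v))" for u A
  \<comment> \<open>\<open>h u\<close> is constant on the cosets belonging to \<open>u\<close>, so
    pairing it with itself or with \<open>f\<close> differs only by the factor
    \<open>card ?V\<close>. Summed over \<open>u\<close>, the right side becomes
    \<open>card ?V\<close> times \<open>\<tau>\<close> times the squared norm of
    \<open>f\<close>.\<close>
  have H: "(\<Sum>A\<in>?X. cnj (h u A) * h u A) = of_nat (card ?V) * (\<Sum>A\<in>?X. cnj (f A) * h u A)" for u
  proof -
    have shift: "h u (A - wedge n u w) = h u A" if A: "A \<in> ?X" and w: "w \<in> ?V" for A w
      unfolding h_def
    proof (rule sum.reindex_bij_witness[of _ "\<lambda>v. v - w" "\<lambda>v. v + w"])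
      fix v assume v: "v \<in> ?V"
      show "v + w - w = v" "v - w + w = v" using v w by auto
      show "v + w \<in> ?V" "v - w \<in> ?V" using v w by auto
      show "f (A - wedge n u (v + w)) = f (A - wedge n u w - wedge n u v)"
        using wedge_diff_right[OF alt_forms_carrier[OF A] v w, of u] by simp
    qed
    have "(\<Sum>A\<in>?X. cnj (h u A) * h u A) = (\<Sum>A\<in>?X. \<Sum>w\<in>?V. cnj (f (A - wedge n u w)) * h u A)"
      unfolding h_def[of u] cnj_sum sum_distrib_right ..
    also have "\<dots> = (\<Sum>w\<in>?V. \<Sum>A\<in>?X. cnj (f (A - wedge n u w)) * h u (A - wedge n u w))"
      by (subst sum.swap) (simp add: shift)
    also have "\<dots> = (\<Sum>w\<in>?V. \<Sum>A\<in>?X. cnj (f A) * h u A)"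
      by (intro sum.cong refl sum_alt_forms_shift)
    finally show ?thesis by simp
  qed
  let ?S = "\<Sum>A\<in>?X. (cmod (f A))\<^sup>2" and ?R = "\<Sum>u\<in>?V. \<Sum>A\<in>?X. (cmod (h u A))\<^sup>2"
  have sq: "cnj z * z = complex_of_real ((cmod z)\<^sup>2)" for z
    unfolding complex_norm_square by (rule mult.commute)
  have "complex_of_real ?R = (\<Sum>u\<in>?V. \<Sum>A\<in>?X. cnj (h u A) * h u A)" unfolding sq by simp
  also have "\<dots> = of_nat (card ?V) * (\<Sum>u\<in>?V. \<Sum>A\<in>?X. cnj (f A) * h u A)"
    unfolding H by (simp add: sum_distrib_left)
  also have "(\<Sum>u\<in>?V. \<Sum>A\<in>?X. cnj (f A) * h u A) = (\<Sum>A\<in>?X. cnj (f A) * (\<Sum>u\<in>?V. h u A))"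
    by (subst sum.swap) (simp add: sum_distrib_left)
  also have "\<dots> = (\<Sum>A\<in>?X. cnj (f A) * (\<tau> * f A))"
    using eig by (intro sum.cong refl) (simp add: h_def sum.cartesian_product)
  also have "\<dots> = \<tau> * (\<Sum>A\<in>?X. cnj (f A) * f A)"
    unfolding sum_distrib_left by (rule sum.cong) (simp_all add: mult_ac)
  also have "(\<Sum>A\<in>?X. cnj (f A) * f A) = complex_of_real ?S" unfolding sq by simp
  finally have e: "complex_of_real ?R = of_nat (card ?V) * (\<tau> * complex_of_real ?S)" .
  have "card ?V > 0" by (simp add: card_carrier_vec)
  moreover have "?S > 0"
    using nz finite_alt_forms by (intro sum_pos2[of _ A0]) auto
  moreover have "\<tau> = complex_of_real (r / (real N * s))"
    if "complex_of_real r = of_nat N * (\<tau> * complex_of_real s)" "N > 0" "s > 0" for r s N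
    using that by (simp add: field_simps)
  ultimately have "\<tau> = complex_of_real (?R / (real (card ?V) * ?S))"
    using e by blast
  moreover have "?R / (real (card ?V) * ?S) \<ge> 0"
    by (intro divide_nonneg_nonneg mult_nonneg_nonneg sum_nonneg) auto
  ultimately show ?thesis by blast
qed

text \<open>The same \<open>P\<close> in \<open>fe\<close> and \<open>se\<close> is self-duality:
  \<open>se\<close> reads column \<open>k\<close> as the function on matrix differences given by
  \<open>E k\<close>, while \<open>fe\<close> reads row \<open>k\<close> as the eigenvalues on
  \<open>E k\<close>.\<close>

locale alt_eigen =
  fixes n d :: nat and E :: "nat \<Rightarrow> 'a :: {field, finite} mat \<Rightarrow> 'a mat \<Rightarrow> complex" and P :: "complex mat"
    and q :: complex
  assumes q: "q = of_nat CARD('a)" and d: "d = n div 2" and d1: "d \<ge> 1"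
    and pi: "primitive_idempotents (alt_forms n) (alt_rel n) d E"
    and fe: "first_eigenmatrix (alt_forms n) (alt_rel n) d E P"
    and se: "second_eigenmatrix (alt_forms n) (alt_rel n) d E P"
begin

abbreviation "X \<equiv> alt_forms n :: 'a mat set"
abbreviation "m \<equiv> q * (q ^ 2 - 1)"

definition "cls A = vec_space.rank n A div 2"

text \<open>
  The intersection numbers \<open>b\<^sub>i\<close>, \<open>c\<^sub>i\<close>, \<open>a\<^sub>i\<close>, multiplied by the number \<open>m\<close> of pairs
  \<open>(u, v)\<close> that represent a given matrix of rank 2 as \<open>wedge n u v\<close>.
\<close>

definition "b i = (q ^ n - q ^ (2 * i)) * (q ^ n - q ^ (2 * i + 1))"
definition "c i = (q ^ (2 * i) - 1) * q ^ (2 * i - 1)"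
definition "a i = b 0 - b i - c i"

lemma rank_cls: "A \<in> X \<Longrightarrow> vec_space.rank n A = 2 * cls A"
  using alt_rank_even unfolding cls_def by fastforce

lemma cls_le: "A \<in> X \<Longrightarrow> cls A \<le> d"
  using vec_space.rank_le_nc[OF alt_forms_carrier, of A n] unfolding cls_def d
  by (simp add: div_le_mono)

lemma finite_X: "finite X" and X_pos: "card X > 0"
proof -
  show "finite X" by (rule finite_alt_forms)
  then show "card X > 0" using zero_alt by (auto simp: card_gt_0_iff)
qed

lemma adj_rel: "A \<in> X \<Longrightarrow> B \<in> X \<Longrightarrow> adj (alt_rel n j) A B = (if cls (A - B) = j then 1 else 0)"
  using rank_cls[OF minus_alt] by (simp add: adj_def alt_rel_def)

lemma E_eq:
  assumes "k \<le> d" "A \<in> X" "B \<in> X"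
  shows "E k A B = P $$ (cls (A - B), k) / of_nat (card X)"
proof -
  have "E k A B = (\<Sum>j\<le>d. P $$ (j, k) * adj (alt_rel n j) A B) / of_nat (card X)"
    using se assms by (simp add: second_eigenmatrix_def)
  also have "(\<Sum>j\<le>d. P $$ (j, k) * adj (alt_rel n j) A B) =
      (\<Sum>j\<le>d. if j = cls (A - B) then P $$ (j, k) else 0)"
    using assms by (intro sum.cong) (auto simp: adj_rel)
  also have "\<dots> = P $$ (cls (A - B), k)"
    using cls_le[OF minus_alt[OF assms(2,3)]] by (subst sum.delta) auto
  finally show ?thesis .
qed

lemma adj_E:
  assumes jk: "j \<le> d" "k \<le> d" and x: "x \<in> X" and z: "z \<in> X"
  shows "(\<Sum>y\<in>X. adj (alt_rel n j) x y * E k y z) = P $$ (k, j) * E k x z"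
proof -
  have "(\<Sum>y\<in>X. adj (alt_rel n j) x y * E k y z) = (\<Sum>y\<in>X. (\<Sum>i\<le>d. P $$ (i, j) * E i x y) * E k y z)"
    using fe jk x by (intro sum.cong) (auto simp: first_eigenmatrix_def)
  also have "\<dots> = (\<Sum>i\<le>d. P $$ (i, j) * (\<Sum>y\<in>X. E i x y * E k y z))"
    unfolding sum_distrib_right sum_distrib_left by (subst sum.swap) (simp add: mult.assoc)
  also have "\<dots> = (\<Sum>i\<le>d. if i = k then P $$ (i, j) * E i x z else 0)"
    using pi jk x z by (intro sum.cong) (auto simp: primitive_idempotents_def)
  also have "\<dots> = P $$ (k, j) * E k x z" using jk by (subst sum.delta) auto
  finally show ?thesis .
qed

lemma sum_adj:
  assumes "A \<in> X"
  shows "(\<Sum>Y\<in>X. adj (alt_rel n j) A Y * g Y) = (\<Sum>Y | Y \<in> X \<and> cls (A - Y) = j. g Y)"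
proof -
  have "(\<Sum>Y\<in>X. adj (alt_rel n j) A Y * g Y) = (\<Sum>Y\<in>X. if Y \<in> {Y \<in> X. cls (A - Y) = j} then g Y else 0)"
    using assms by (intro sum.cong) (auto simp: adj_rel)
  also have "\<dots> = (\<Sum>Y\<in>X \<inter> {Y \<in> X. cls (A - Y) = j}. g Y)"
    by (rule sum.inter_restrict[symmetric]) (rule finite_X)
  also have "X \<inter> {Y \<in> X. cls (A - Y) = j} = {Y \<in> X. cls (A - Y) = j}" by blast
  finally show ?thesis .
qed

text \<open>This is \<open>adj_E\<close> for the column of \<open>E k\<close> at the zero matrix,
  which by \<open>E_eq\<close> is column \<open>k\<close> of \<open>P\<close> up to scaling.\<close>

lemma sum_class:
  assumes "j \<le> d" "k \<le> d" "A \<in> X"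
  shows "(\<Sum>Y | Y \<in> X \<and> cls (A - Y) = j. P $$ (cls Y, k)) = P $$ (k, j) * P $$ (cls A, k)"
proof -
  have 0: "A - 0\<^sub>m n n = A" if "A \<in> X" for A
    using alt_forms_carrier[OF that] by (intro eq_matI) auto
  have "(\<Sum>Y | Y \<in> X \<and> cls (A - Y) = j. E k Y (0\<^sub>m n n)) = P $$ (k, j) * E k A (0\<^sub>m n n)"
    using adj_E[OF assms zero_alt] sum_adj[OF assms(3), of j "\<lambda>Y. E k Y (0\<^sub>m n n)"] by simp
  moreover have "(\<Sum>Y | Y \<in> X \<and> cls (A - Y) = j. E k Y (0\<^sub>m n n)) =
      (\<Sum>Y | Y \<in> X \<and> cls (A - Y) = j. P $$ (cls Y, k) / of_nat (card X))"
    using assms by (intro sum.cong) (auto simp: E_eq[OF _ _ zero_alt] 0)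
  ultimately have "(\<Sum>Y | Y \<in> X \<and> cls (A - Y) = j. P $$ (cls Y, k)) / of_nat (card X) =
      P $$ (k, j) * P $$ (cls A, k) / of_nat (card X)"
    using E_eq[OF assms(2,3) zero_alt] 0[OF assms(3)] by (simp add: sum_divide_distrib)
  then show ?thesis using X_pos by simp
qed

lemma P_nonzero: "k \<le> d \<Longrightarrow> \<exists>A\<in>X. P $$ (cls A, k) \<noteq> 0"
proof -
  assume k: "k \<le> d"
  then obtain x y where xy: "x \<in> X" "y \<in> X" "E k x y \<noteq> 0"
    using pi by (auto simp: primitive_idempotents_def)
  then have "P $$ (cls (x - y), k) \<noteq> 0" using E_eq[OF k xy(1,2)] by auto
  then show ?thesis using minus_alt[OF xy(1,2)] by blast
qed

lemma P_0: "k \<le> d \<Longrightarrow> P $$ (k, 0) = 1"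
proof -
  assume k: "k \<le> d"
  obtain A where A: "A \<in> X" "P $$ (cls A, k) \<noteq> 0" using P_nonzero[OF k] by blast
  have "{Y \<in> X. cls (A - Y) = 0} = {A}"
  proof (intro equalityI subsetI)
    fix Y assume Y: "Y \<in> {Y \<in> X. cls (A - Y) = 0}"
    then have "vec_space.rank n (A - Y) = 0" using rank_cls[OF minus_alt[OF A(1)], of Y] by simp
    then have "A - Y = 0\<^sub>m n n"
      using Y alt_forms_carrier[OF minus_alt[OF A(1)], of Y] by (intro rank_0_eq_zero) auto
    then have e: "(A - Y) $$ (i, j) = 0" if "i < n" "j < n" for i j using that by simp
    have C: "A \<in> carrier_mat n n" "Y \<in> carrier_mat n n" using A Y alt_forms_carrier by auto
    have "A = Y"
    proof (rule eq_matI)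
      fix i j assume "i < dim_row Y" "j < dim_col Y"
      then show "A $$ (i, j) = Y $$ (i, j)" using e[of i j] C by auto
    qed (use C in auto)
    then show "Y \<in> {A}" by simp
  next
    fix Y assume "Y \<in> {A}"
    then show "Y \<in> {Y \<in> X. cls (A - Y) = 0}"
      using A minus_r_inv_mat[OF alt_forms_carrier[OF A(1)]] by (simp add: cls_def rank_zero)
  qed
  then show ?thesis using sum_class[OF _ k A(1), of 0] A(2) by simp
qed

text \<open>The constant \<open>q ^ (2 * n) - b 0\<close> counts the pairs whose wedge is 0.\<close>

lemma sum_wedge_P:
  assumes k: "k \<le> d" and A: "A \<in> X"
  shows "(\<Sum>(u, v)\<in>carrier_vec n \<times> carrier_vec n. P $$ (cls (A - wedge n u v), k)) =
    (m * P $$ (k, 1) + q ^ (2 * n) - b 0) * P $$ (cls A, k)"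
proof -
  have "{Y \<in> X. vec_space.rank n (A - Y) = 2} = {Y \<in> X. cls (A - Y) = 1}"
    using rank_cls[OF minus_alt[OF A]] by auto
  then show ?thesis
    using sum_wedge[OF A, folded q, of "\<lambda>Y. P $$ (cls Y, k)"] sum_class[OF d1 k A]
    by (simp add: b_def algebra_simps)
qed

text \<open>The translation sum of column \<open>k\<close> at a matrix of class \<open>i\<close> is
  evaluated twice, by the rank counts and by the eigenvalue. The indices \<open>i + 1\<close> at
  \<open>i = d\<close> and \<open>i - 1\<close> at \<open>i = 0\<close> are out of range or
  truncated, but their coefficients \<open>b d\<close> and \<open>c 0\<close> vanish.\<close>

lemma P_row_class:
  assumes k: "k \<le> d" and A: "A \<in> X" "cls A = i"
  shows "b i * P $$ (i + 1, k) + c i * P $$ (i - 1, k) + a i * P $$ (i, k) = m * P $$ (k, 1) * P $$ (i, k)"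
proof -
  have r: "vec_space.rank n A = 2 * i" using rank_cls A by simp
  have lo: "of_nat (card (lower_pairs n A)) = c i"
  proof -
    have "q * of_nat (card (lower_pairs n A)) = (q ^ (2 * i) - 1) * q ^ (2 * i)"
      using card_lower_pairs[OF A(1), folded q] r by simp
    \<comment> \<open>At \<open>i = 0\<close> the exponent \<open>2 * i - 1\<close> in
      \<open>c\<close> is truncated; both sides are 0 there.\<close>
    also have "\<dots> = q * c i" by (cases i) (simp_all add: c_def)
    finally show ?thesis by (simp add: q)
  qed
  have ra: "of_nat (card (raise_pairs n A)) = b i"
    using card_raise_pairs[OF A(1), folded q] r by (simp add: b_def)
  have "(2 * i + 2) div 2 = i + 1" "(2 * i - 2) div 2 = i - 1" "2 * i div 2 = i" by auto
  then have "(m * P $$ (k, 1) + q ^ (2 * n) - b 0) * P $$ (i, k) =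
      b i * P $$ (i + 1, k) + c i * P $$ (i - 1, k) + (q ^ (2 * n) - b i - c i) * P $$ (i, k)"
    using sum_rank_wedge[OF A(1), folded q, of "\<lambda>k'. P $$ (k' div 2, k)"]
      sum_wedge_P[OF k A(1), unfolded cls_def[of "A - _"]] A(2)
    unfolding r lo ra by simp
  moreover have "\<beta> * y + \<gamma> * w + (\<beta>0 - \<beta> - \<gamma>) * x = M * x"
    if "(M + z - \<beta>0) * x = \<beta> * y + \<gamma> * w + (z - \<beta> - \<gamma>) * x" for M z \<beta>0 \<beta> \<gamma> w x y :: complex
    using that by (simp add: algebra_simps)
  ultimately show ?thesis unfolding a_def by blast
qed

lemma b_nonzero: "2 * i + 1 < n \<Longrightarrow> b i \<noteq> 0"
proof -
  assume i: "2 * i + 1 < n"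
  have "q ^ n \<noteq> q ^ j" if "j < n" for j
  proof -
    have "CARD('a) ^ j < CARD('a) ^ n"
      using card_field_ge_2[where 'a='a] that by (intro power_strict_increasing) auto
    then have "of_nat (CARD('a) ^ n) \<noteq> (of_nat (CARD('a) ^ j) :: complex)"
      unfolding of_nat_eq_iff by simp
    then show ?thesis by (simp add: q)
  qed
  from this[of "2 * i"] this[of "2 * i + 1"] i show ?thesis
    unfolding b_def by simp
qed

text \<open>Climbs one class at a time: \<open>b i \<noteq> 0\<close> provides a raising
  pair.\<close>

lemma ex_class: "i \<le> d \<Longrightarrow> \<exists>A\<in>X. cls A = i"
proof (induction i)
  case 0
  then show ?case using zero_alt by (intro bexI[of _ "0\<^sub>m n n"]) (auto simp: cls_def rank_zero)
next
  case (Suc i)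
  then obtain A where A: "A \<in> X" "cls A = i" by auto
  have "2 * i + 1 < n" using Suc.prems d by linarith
  then have "of_nat (card (raise_pairs n A)) \<noteq> (0 :: complex)"
    using card_raise_pairs[OF A(1), folded q] rank_cls[OF A(1)] A(2) b_nonzero[of i] by (simp add: b_def)
  then have "raise_pairs n A \<noteq> {}" by auto
  then obtain u v where "(u, v) \<in> raise_pairs n A" by auto
  then have "vec_space.rank n (A - wedge n u v) = 2 * i + 2"
    using rank_raise[OF A(1)] rank_cls[OF A(1)] A(2) by simp
  then show ?case using minus_alt[OF A(1) wedge_alt[of n u v]]
    by (intro bexI[of _ "A - wedge n u v"]) (auto simp: cls_def)
qed

lemma P_row:
  assumes "i \<le> d" "k \<le> d"
  shows "b i * P $$ (i + 1, k) + c i * P $$ (i - 1, k) + a i * P $$ (i, k) = m * P $$ (k, 1) * P $$ (i, k)"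
  using ex_class[OF assms(1)] P_row_class[OF assms(2)] by blast

text \<open>Inserts the expansion of \<open>E k\<close> from \<open>se\<close> into the expansion of
  the adjacency matrix from \<open>fe\<close>.\<close>

lemma P_square:
  assumes "i \<le> d" "j \<le> d"
  shows "(\<Sum>k\<le>d. P $$ (i, k) * P $$ (k, j)) = (if i = j then of_nat (card X) else 0)"
proof -
  obtain A where A: "A \<in> X" "cls A = i" using ex_class[OF assms(1)] by blast
  have 0: "A - 0\<^sub>m n n = A"
    using alt_forms_carrier[OF A(1)] by (intro eq_matI) auto
  have "adj (alt_rel n j) A (0\<^sub>m n n) = (\<Sum>k\<le>d. P $$ (k, j) * E k A (0\<^sub>m n n))"
    using fe assms A(1) zero_alt by (auto simp: first_eigenmatrix_def)
  then have "(if i = j then 1 else 0) = (\<Sum>k\<le>d. P $$ (k, j) * (P $$ (i, k) / of_nat (card X)))"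
    using adj_rel[OF A(1) zero_alt, of j] A 0 by (simp add: E_eq[OF _ A(1) zero_alt])
  also have "\<dots> = (\<Sum>k\<le>d. P $$ (i, k) * P $$ (k, j)) / of_nat (card X)"
    by (simp add: sum_divide_distrib mult.commute)
  finally show ?thesis using X_pos by (simp add: field_simps split: if_splits)
qed

text \<open>The source of the sign condition under which the cubic has no root.\<close>

lemma eigenvalue_nonneg: "k \<le> d \<Longrightarrow> \<exists>\<rho> \<ge> 0. m * P $$ (k, 1) + q ^ (2 * n) - b 0 = complex_of_real \<rho>"
proof -
  assume k: "k \<le> d"
  obtain A0 where "A0 \<in> X" "P $$ (cls A0, k) \<noteq> 0" using P_nonzero[OF k] by blast
  then show ?thesis
    using wedge_sum_eigenvalue_nonneg[where f = "\<lambda>A. P $$ (cls A, k)", OF sum_wedge_P[OF k]] by blast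
qed

end

subsection \<open>The equations satisfied by the eigenvalues and by the diagonal entries\<close>

text \<open>
  Coefficients of the cubic that is left of the eigenvalue equation after removing its linear
  factors.
\<close>

definition cub0 :: "'a :: comm_ring_1 \<Rightarrow> 'a \<Rightarrow> 'a" where
  "cub0 p q = p^6*q^6 - p^5*q^8 - p^5*q^7 - 3*p^5*q^6 - 3*p^5*q^5 - 2*p^5*q^4 - 2*p^5*q^3 + p^4*q^9
    + 3*p^4*q^8 + 6*p^4*q^7 + 7*p^4*q^6 + 10*p^4*q^5 + 5*p^4*q^4 + 5*p^4*q^3 + p^4*q^2
    - 3*p^3*q^9 - 5*p^3*q^8 - 11*p^3*q^7 - 12*p^3*q^6 - 13*p^3*q^5 - 10*p^3*q^4 - 5*p^3*q^3
    - 4*p^3*q^2 - p^3 + 2*p^2*q^9 + 7*p^2*q^8 + 8*p^2*q^7 + 14*p^2*q^6 + 9*p^2*q^5 + 10*p^2*q^4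
    + 4*p^2*q^3 + 4*p^2*q^2 + p^2*q + p^2 - 4*p*q^8 - 4*p*q^7 - 6*p*q^6 - 6*p*q^5 - 3*p*q^4
    - 3*p*q^3 - p*q^2 - p*q + 2*q^7 + 2*q^5 + q^3"

definition cub1 :: "'a :: comm_ring_1 \<Rightarrow> 'a \<Rightarrow> 'a" where
  "cub1 p q = p^4*q^6 + 2*p^4*q^4 - p^3*q^8 - p^3*q^7 - 3*p^3*q^6 - p^3*q^5 + p^3*q^3 + 3*p^3*q^2 + p^3*q
    + p^3 + p^2*q^9 + p^2*q^8 + 4*p^2*q^7 + p^2*q^6 + 3*p^2*q^5 - 3*p^2*q^4 - p^2*q^3
    - 4*p^2*q^2 - p^2*q - p^2 - p*q^9 - p*q^8 - 3*p*q^7 - 3*p*q^6 + p*q^3 + p*q^2 + q^8 + 2*q^6"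

definition cub2 :: "'a :: comm_ring_1 \<Rightarrow> 'a \<Rightarrow> 'a" where
  "cub2 p q = p^2*q^5 + p^2*q^4 + 3*p^2*q^3 + 2*p^2*q^2 + 2*p^2*q - p*q^6 - p*q^5 - 3*p*q^4 - 3*p*q^3
    - 2*p*q^2 - 2*p*q + q^5 + 2*q^3"

definition cub3 :: "'a :: comm_ring_1 \<Rightarrow> 'a \<Rightarrow> 'a" where
  "cub3 p q = p*q^3 + p*q^2 - q^4 - q^2"

section \<open>Positivity of the cubic\<close>

lemma cub0_pos:
  fixes s t :: real
  assumes "s \<ge> 0" "t \<ge> 0"
  shows "cub0 ((s + 2) ^ 3 + t) (s + 2) > 0"
proof -
  \<comment> \<open>In terms of \<open>s\<close> and \<open>t\<close> all coefficients are positive.\<close>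
  have "cub0 ((s + 2) ^ 3 + t) (s + 2) =
      t^6*s^6 + 12*t^6*s^5 + 60*t^6*s^4 + 160*t^6*s^3 + 240*t^6*s^2 + 192*t^6*s + 64*t^6
      + 6*t^5*s^9 + 107*t^5*s^8 + 847*t^5*s^7 + 3903*t^5*s^6 + 11525*t^5*s^5 + 22580*t^5*s^4
      + 29286*t^5*s^3 + 24164*t^5*s^2 + 11448*t^5*s + 2352*t^5 + 15*t^4*s^12 + 355*t^4*s^11
      + 3845*t^4*s^10 + 25186*t^4*s^9 + 111036*t^4*s^8 + 346748*t^4*s^7 + 785509*t^4*s^6
      + 1298518*t^4*s^5 + 1551317*t^4*s^4 + 1302557*t^4*s^3 + 726887*t^4*s^2 + 240832*t^4*s
      + 35580*t^4 + 20*t^3*s^15 + 590*t^3*s^14 + 8110*t^3*s^13 + 68874*t^3*s^12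
      + 403918*t^3*s^11 + 1731624*t^3*s^10 + 5601725*t^3*s^9 + 13911005*t^3*s^8
      + 26707145*t^3*s^7 + 39584246*t^3*s^6 + 44847339*t^3*s^5 + 38060340*t^3*s^4
      + 23358195*t^3*s^3 + 9753150*t^3*s^2 + 2466404*t^3*s + 283015*t^3 + 15*t^2*s^18
      + 530*t^2*s^17 + 8830*t^2*s^16 + 92136*t^2*s^15 + 674468*t^2*s^14 + 3676640*t^2*s^13
      + 15458781*t^2*s^12 + 51229925*t^2*s^11 + 135554691*t^2*s^10 + 288284108*t^2*s^9
      + 493454522*t^2*s^8 + 677425130*t^2*s^7 + 739315531*t^2*s^6 + 631690937*t^2*s^5
      + 412429664*t^2*s^4 + 198044185*t^2*s^3 + 65650266*t^2*s^2 + 13348141*t^2*s + 1244955*t^2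
      + 6*t*s^21 + 247*t*s^20 + 4835*t*s^19 + 59839*t*s^18 + 525141*t*s^17 + 3473828*t*s^16
      + 17973673*t*s^15 + 74491495*t*s^14 + 251202611*t*s^13 + 696249126*t*s^12
      + 1595402019*t*s^11 + 3029452292*t*s^10 + 4763050233*t*s^9 + 6175568492*t*s^8
      + 6552904672*t*s^7 + 5622904415*t*s^6 + 3833029014*t*s^5 + 2022021335*t*s^4
      + 793184423*t*s^3 + 216851857*t*s^2 + 36656303*t*s + 2860002*t + s^24 + 47*s^23
      + 1057*s^22 + 15134*s^21 + 154840*s^20 + 1204452*s^19 + 7399210*s^18 + 36809309*s^17
      + 150855308*s^16 + 515409883*s^15 + 1479906533*s^14 + 3589368830*s^13 + 7372987553*s^12
      + 12831753465*s^11 + 18888046036*s^10 + 23421280337*s^9 + 24306287768*s^8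
      + 20909209424*s^7 + 14708261310*s^6 + 8299930441*s^5 + 3655558801*s^4 + 1206073057*s^3
      + 279023198*s^2 + 40091580*s + 2664344"
    unfolding cub0_def by Groebner_Basis.algebra
  also have "\<dots> > 0"
    using assms by (intro add_nonneg_pos add_nonneg_nonneg mult_nonneg_nonneg zero_le_power) simp_all
  finally show ?thesis .
qed

text \<open>Half of the leading term \<open>p^4 q^6\<close> is kept as an explicit margin, to
  outweigh the negative term with \<open>cub2\<close> in \<open>cubic_pos\<close>.\<close>

lemma cub1_ge:
  fixes s t :: real
  assumes "s \<ge> 0" "t \<ge> 0"
  shows "2 * cub1 ((s + 2) ^ 3 + t) (s + 2) \<ge> ((s + 2) ^ 3 + t) ^ 4 * (s + 2) ^ 6"
proof -
  have "2 * cub1 ((s + 2) ^ 3 + t) (s + 2) - ((s + 2) ^ 3 + t) ^ 4 * (s + 2) ^ 6 =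
      t^4*s^6 + 12*t^4*s^5 + 64*t^4*s^4 + 192*t^4*s^3 + 336*t^4*s^2 + 320*t^4*s + 128*t^4
      + 4*t^3*s^9 + 70*t^3*s^8 + 558*t^3*s^7 + 2654*t^3*s^6 + 8270*t^3*s^5 + 17428*t^3*s^4
      + 24722*t^3*s^3 + 22674*t^3*s^2 + 12178*t^3*s + 2926*t^3 + 6*t^2*s^12 + 138*t^2*s^11
      + 1470*t^2*s^10 + 9584*t^2*s^9 + 42548*t^2*s^8 + 135304*t^2*s^7 + 315512*t^2*s^6
      + 542744*t^2*s^5 + 682768*t^2*s^4 + 612420*t^2*s^3 + 372240*t^2*s^2 + 138126*t^2*s
      + 23802*t^2 + 4*t*s^15 + 114*t*s^14 + 1522*t*s^13 + 12622*t*s^12 + 72670*t*s^11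
      + 307444*t*s^10 + 986544*t*s^9 + 2442940*t*s^8 + 4703476*t*s^7 + 7038740*t*s^6
      + 8123088*t*s^5 + 7109068*t*s^4 + 4579998*t*s^3 + 2060118*t*s^2 + 582256*t*s + 78520*t
      + s^18 + 34*s^17 + 546*s^16 + 5500*s^15 + 38920*s^14 + 205304*s^13 + 835954*s^12
      + 2684090*s^11 + 6883042*s^10 + 14191114*s^9 + 23566070*s^8 + 31442686*s^7 + 33481160*s^6
      + 28126666*s^5 + 18307348*s^4 + 8970352*s^3 + 3146528*s^2 + 713248*s + 79424"
    unfolding cub1_def by Groebner_Basis.algebra
  also have "\<dots> \<ge> 0"
    using assms by (intro add_nonneg_nonneg mult_nonneg_nonneg zero_le_power) simp_all
  finally show ?thesis by simp
qed

text \<open>Only the quadratic term can be negative. The constant term is positive, and the rest is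
  \<open>z\<close> times a quadratic whose middle term is absorbed by completing the square. The
  bound \<open>p \<ge> q ^ 3\<close> is the form that \<open>n > 5\<close> takes for
  \<open>p = q^(n-3)\<close>.\<close>

lemma cubic_pos:
  fixes p q z :: real
  assumes q: "q \<ge> 2" and p: "p \<ge> q ^ 3" and z: "z \<ge> 0"
  shows "cub0 p q + cub1 p q * z - cub2 p q * z ^ 2 + cub3 p q * z ^ 3 > 0"
proof -
  define s where "s = q - 2"
  define t where "t = p - q ^ 3"
  have st: "s \<ge> 0" "t \<ge> 0" "q = s + 2" "p = (s + 2) ^ 3 + t" using q p by (auto simp: s_def t_def)
  have c0: "cub0 p q > 0" using cub0_pos[OF st(1,2)] by (simp only: st)
  have c1: "2 * cub1 p q \<ge> p ^ 4 * q ^ 6" using cub1_ge[OF st(1,2)] by (simp only: st)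
  have q3: "q ^ 3 \<ge> 2 * q ^ 2" "q ^ 2 \<ge> 2 * q" "q ^ 4 \<ge> 2 * q ^ 3" "q ^ 5 \<ge> 2 * q ^ 4"
    using q by (simp_all add: power_def mult_right_mono)
  have "q ^ 3 > 0" using q by simp
  then have p0: "p > 0" using p by linarith
  have "p \<ge> q ^ 2 + 1" using p q3 q by linarith
  then have "q ^ 2 * (p - q ^ 2 - 1) \<ge> 0" by simp
  moreover have "cub3 p q = p * q ^ 3 + q ^ 2 * (p - q ^ 2 - 1)" unfolding cub3_def by Groebner_Basis.algebra
  ultimately have c3: "cub3 p q \<ge> p * q ^ 3" by linarith
  \<comment> \<open>\<open>21 / 8\<close> is the value of
    \<open>1 + 1/q + 3/q^2 + 2/q^3 + 2/q^4\<close> at \<open>q = 2\<close>, its maximum for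
    \<open>q \<ge> 2\<close>.\<close>
  have c2: "8 * cub2 p q \<le> 21 * (p ^ 2 * q ^ 5)"
  proof -
    have "8 * (x5 + x4 + 3 * x3 + 2 * x2 + 2 * x1) \<le> 21 * x5"
      if "x2 \<ge> 2 * x1" "x3 \<ge> 2 * x2" "x4 \<ge> 2 * x3" "x5 \<ge> 2 * x4" for x1 x2 x3 x4 x5 :: real
    proof -
      have "2 * x4 \<le> x5" "4 * x3 \<le> x5" using that by linarith+
      moreover have "8 * x2 \<le> x5" using that calculation by linarith
      moreover have "16 * x1 \<le> x5" using that calculation by linarith
      ultimately show ?thesis by simp
    qed
    from this[OF q3(2,1,3,4)]
    have "8 * (q ^ 5 + q ^ 4 + 3 * q ^ 3 + 2 * q ^ 2 + 2 * q) \<le> 21 * q ^ 5" .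
    then have 1: "p ^ 2 * (8 * (q ^ 5 + q ^ 4 + 3 * q ^ 3 + 2 * q ^ 2 + 2 * q)) \<le> p ^ 2 * (21 * q ^ 5)"
      by (intro mult_left_mono) auto
    have 2: "p * q ^ 6 \<ge> q ^ 3 * q ^ 6" using p q by (intro mult_right_mono) auto
    have 3: "q ^ 3 * q ^ 6 \<ge> q ^ 5 + 2 * q ^ 3"
    proof -
      have "q ^ 3 * q ^ 6 = q ^ 4 * q ^ 5" by Groebner_Basis.algebra
      moreover have "q ^ 4 \<ge> 2" using q3 q by linarith
      then have "q ^ 4 * q ^ 5 \<ge> 2 * q ^ 5" using q by (intro mult_right_mono) auto
      moreover have "q ^ 5 \<ge> 0" using q by simp
      ultimately show ?thesis using q3 by linarith
    qed
    have 4: "p * (q ^ 5 + 3 * q ^ 4 + 3 * q ^ 3 + 2 * q ^ 2 + 2 * q) \<ge> 0" using p0 q by simp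
    have 5: "8 * cub2 p q = p ^ 2 * (8 * (q ^ 5 + q ^ 4 + 3 * q ^ 3 + 2 * q ^ 2 + 2 * q))
        - 8 * (p * q ^ 6) - 8 * (p * (q ^ 5 + 3 * q ^ 4 + 3 * q ^ 3 + 2 * q ^ 2 + 2 * q)) + 8 * (q ^ 5 + 2 * q ^ 3)"
      unfolding cub2_def by Groebner_Basis.algebra
    have "c \<le> a" if "a' \<le> a" "h \<le> g" "r \<le> h" "0 \<le> w" "c = a' - 8 * g - 8 * w + 8 * r"
      for a a' c g h r w :: real using that by linarith
    from this[OF 1 2 3 4 5] show ?thesis by (simp add: mult_ac)
  qed
  have "16 * (cub1 p q - cub2 p q * z + cub3 p q * z ^ 2) \<ge>
      8 * (p ^ 4 * q ^ 6) - 42 * (p ^ 2 * q ^ 5) * z + 16 * (p * q ^ 3) * z ^ 2"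
    using c1 mult_right_mono[OF c2 z] mult_right_mono[OF c3, of "z ^ 2"] by (simp add: algebra_simps)
  \<comment> \<open>Splits \<open>p\<close> in the last term into \<open>p - q ^ 3\<close> and
    \<open>q ^ 3\<close> and completes the square; what remains is nonnegative because
    \<open>q ^ 2 \<ge> 4\<close> and \<open>441 / 8 < 64\<close>.\<close>
  also have "8 * (p ^ 4 * q ^ 6) - 42 * (p ^ 2 * q ^ 5) * z + 16 * (p * q ^ 3) * z ^ 2 =
      16 * q ^ 3 * ((p - q ^ 3) * z ^ 2) + q ^ 6 * (8 * (p ^ 2 - (21 / 8) * (z / q)) ^ 2) +
      (16 * q ^ 6 * z ^ 2 - 441 / 8 * q ^ 4 * z ^ 2)"
    using q by (simp add: field_simps power2_eq_square) Groebner_Basis.algebra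
  finally have *: "16 * (cub1 p q - cub2 p q * z + cub3 p q * z ^ 2) \<ge> \<dots>" .
  have "q ^ 2 \<ge> 4" using q3 q by linarith
  then have "16 * q ^ 2 - 441 / 8 \<ge> 0" by simp
  then have "(16 * q ^ 2 - 441 / 8) * (q ^ 4 * z ^ 2) \<ge> 0" by (intro mult_nonneg_nonneg) auto
  moreover have "(16 * q ^ 2 - 441 / 8) * (q ^ 4 * z ^ 2) = 16 * q ^ 6 * z ^ 2 - 441 / 8 * q ^ 4 * z ^ 2"
    by (simp add: left_diff_distrib) Groebner_Basis.algebra
  ultimately have "16 * q ^ 6 * z ^ 2 - 441 / 8 * q ^ 4 * z ^ 2 \<ge> 0" by simp
  moreover have "16 * q ^ 3 * ((p - q ^ 3) * z ^ 2) \<ge> 0" using p q by (intro mult_nonneg_nonneg) auto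
  moreover have "q ^ 6 * (8 * (p ^ 2 - (21 / 8) * (z / q)) ^ 2) \<ge> 0" by simp
  ultimately have "16 * (cub1 p q - cub2 p q * z + cub3 p q * z ^ 2) \<ge> 0"
    by (intro order_trans[OF _ *] add_nonneg_nonneg)
  then have "cub1 p q - cub2 p q * z + cub3 p q * z ^ 2 \<ge> 0" by simp
  then have "z * (cub1 p q - cub2 p q * z + cub3 p q * z ^ 2) \<ge> 0" using z by simp
  then show ?thesis using c0 by (simp add: algebra_simps power2_eq_square power3_eq_cube)
qed

text \<open>
  Here \<open>p\<close> stands for \<open>q\<^bsup>n-3\<^esup>\<close> and \<open>T1\<close>, \<open>T2\<close>, \<open>T3\<close> for \<open>m P\<^sub>1(i)\<close>. The parameter \<open>y\<close> of
  \<open>P\<^sub>1(1)\<close> is \<open>1\<close> for the standard ordering and \<open>q\<^sup>2\<close> if \<open>P\<^sub>1(1)\<close> is the valency.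
\<close>

lemma eigenvalue_cases:
  fixes y p q m B0 B1 B2 C2 A1 A2 T1 T2 T3 P12 P22 P32 :: "'a :: field"
  assumes m: "m = q * (q ^ 2 - 1)" and B0: "B0 = (q ^ 3 * p - 1) * (q ^ 3 * p - q)"
    and B1: "B1 = (q ^ 3 * p - q ^ 2) * (q ^ 3 * p - q ^ 3)"
    and B2: "B2 = (q ^ 3 * p - q ^ 4) * (q ^ 3 * p - q ^ 5)"
    and C2: "C2 = (q ^ 4 - 1) * q ^ 3" and A1: "A1 = B0 - B1 - m" and A2: "A2 = B0 - B2 - C2"
    and T1: "T1 = q ^ 4 * p ^ 2 * y - (q + 1) * q ^ 3 * p + q"
    and r1: "B1 * T2 + m * B0 + A1 * T1 = T1 * T1"
    and r2: "B2 * T3 + C2 * T1 + A2 * T2 = T1 * T2"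
    and g1: "m * B0 + A1 * T1 + C2 * (m * P12) = T1 * T1"
    and g2: "m * B0 + A1 * T2 + C2 * (m * P22) = T2 * T2"
    and g3: "m * B0 + A1 * T3 + C2 * (m * P32) = T3 * T3"
    and r3: "B2 * P32 + C2 * P12 + A2 * P22 = T2 * P22"
    and nz: "q \<noteq> 0" "p \<noteq> 0" "m \<noteq> 0" "B1 \<noteq> 0" "B2 \<noteq> 0"
  shows "y = q ^ 2 \<or> y = 1 \<or> cub0 p q + cub1 p q * (p ^ 2 * y) - cub2 p q * (p ^ 2 * y) ^ 2 + cub3 p q * (p ^ 2 * y) ^ 3 = 0"
proof (cases "y = q ^ 2")
  case False
  \<comment> \<open>The names come from the factorizations \<open>T1 - B0 = q^4 p^2 w\<close>,
    \<open>T1 + m = q^3 u\<close>, \<open>B1 = q^5 b\<close> and \<open>B2 = q^6 b'\<close>.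
    \<open>N2\<close> and \<open>N3\<close> are \<open>T2\<close> and \<open>T3\<close> with
    denominators cleared, and \<open>V\<close> is the factor left in \<open>T3 - T2\<close>.\<close>
  define w where "w = y - q ^ 2"
  define b where "b = (q * p - 1) * (p - 1)"
  define b' where "b' = (p - q) * (p - q ^ 2)"
  define u where "u = b + q * p ^ 2 * (y - 1)"
  define N2 where "N2 = b * T1 + q ^ 2 * p ^ 2 * w * u"
  define V where "V = N2 + q * (q ^ 4 - 1) * u"
  define N3 where "N3 = q ^ 2 * b' * N2 + p ^ 2 * w * V"
  have w: "w \<noteq> 0" using False by (simp add: w_def)
  have b1: "B1 = q ^ 5 * b" and b2: "B2 = q ^ 6 * b'" unfolding B1 B2 b_def b'_def by Groebner_Basis.algebra+
  have bnz: "b \<noteq> 0" "b' \<noteq> 0" using nz b1 b2 by auto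
  have t1: "T1 - B0 = q ^ 4 * p ^ 2 * w" unfolding T1 B0 w_def by Groebner_Basis.algebra
  have t1': "T1 + m = q ^ 3 * u" unfolding T1 m u_def b_def by Groebner_Basis.algebra
  have "q ^ 5 * (b * T2) = q ^ 5 * N2"
  proof -
    have "B1 * (T2 - T1) = (T1 - B0) * (T1 + m)" using r1 unfolding A1 by Groebner_Basis.algebra
    then show ?thesis unfolding t1 t1' b1 N2_def by Groebner_Basis.algebra
  qed
  then have T2: "b * T2 = N2" using nz by simp
  have d2: "b * (T2 - T1) = q ^ 2 * p ^ 2 * w * u" using T2 unfolding N2_def by Groebner_Basis.algebra
  have d3: "b * (B2 * (T3 - T2)) = q ^ 4 * p ^ 2 * w * V"
  proof -
    have "B2 * (T3 - T2) = (T1 - B0) * T2 + C2 * (T2 - T1)" using r2 unfolding A2 by Groebner_Basis.algebra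
    then have "b * (B2 * (T3 - T2)) = (T1 - B0) * (b * T2) + C2 * (b * (T2 - T1))" by Groebner_Basis.algebra
    then show ?thesis unfolding T2 d2 t1 C2 V_def by Groebner_Basis.algebra
  qed
  have "q ^ 4 * (q ^ 2 * b' * b * T3) = q ^ 4 * N3" using d3 T2 unfolding b2 N3_def by Groebner_Basis.algebra
  then have T3: "q ^ 2 * b' * b * T3 = N3" using nz by simp
  \<comment> \<open>\<open>r3\<close>, the recurrence in row 2 and column 2, is the one relation not
    yet used. Multiplied by \<open>m * C2\<close>, its entries of column 2 can be replaced by
    quadratics in \<open>T1\<close>, \<open>T2\<close>, \<open>T3\<close> through the dual relations
    \<open>g1\<close>, \<open>g2\<close>, \<open>g3\<close>.\<close>
  have e: "B2 * (m * (C2 * P32)) + C2 * (m * (C2 * P12)) + A2 * (m * (C2 * P22)) = T2 * (m * (C2 * P22))"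
    using r3 by Groebner_Basis.algebra
  have g: "m * (C2 * P12) = T1 * T1 - A1 * T1 - m * B0" "m * (C2 * P22) = T2 * T2 - A1 * T2 - m * B0"
    "m * (C2 * P32) = T3 * T3 - A1 * T3 - m * B0"
    using g1 g2 g3 by Groebner_Basis.algebra+
  have main: "B2 * (T3 - T2) * (T3 + T2 - A1) - C2 * (T2 - T1) * (T1 + T2 - A1) = (T2 - B0) * (T2 * T2 - A1 * T2 - m * B0)"
    using e unfolding g A2 by Groebner_Basis.algebra
  have t2: "b * (T2 - B0) = q ^ 2 * p ^ 2 * w * (q ^ 2 * b + u)" using d2 t1 by Groebner_Basis.algebra
  \<comment> \<open>All differences in \<open>main\<close> are multiples of \<open>w\<close>,
    because constant eigenvalues equal to the valency \<open>B0\<close> always satisfy the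
    relations; that trivial solution is divided out here.\<close>
  have "(q ^ 2 * p ^ 2 * w) * (q ^ 2 * V * (T3 + T2 - A1) - q ^ 3 * (q ^ 4 - 1) * u * (T1 + T2 - A1)
      - (q ^ 2 * b + u) * (T2 * T2 - A1 * T2 - m * B0)) = 0"
  proof -
    have "b * (B2 * (T3 - T2)) * (T3 + T2 - A1) - C2 * (b * (T2 - T1)) * (T1 + T2 - A1)
        = b * (T2 - B0) * (T2 * T2 - A1 * T2 - m * B0)" using main by Groebner_Basis.algebra
    then show ?thesis unfolding d2 d3 t2 C2 by Groebner_Basis.algebra
  qed
  then have "q ^ 2 * V * (T3 + T2 - A1) - q ^ 3 * (q ^ 4 - 1) * u * (T1 + T2 - A1)
      - (q ^ 2 * b + u) * (T2 * T2 - A1 * T2 - m * B0) = 0" using nz w by simp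
  then have "q ^ 2 * V * (b * (q ^ 2 * b' * b * T3) + q ^ 2 * b' * b * (b * T2 - A1 * b))
      - q ^ 3 * (q ^ 4 - 1) * u * q ^ 2 * b' * b * (b * T1 + b * T2 - A1 * b)
      - (q ^ 2 * b + u) * q ^ 2 * b' * ((b * T2) * (b * T2) - A1 * b * (b * T2) - m * B0 * b * b) = 0"
    by Groebner_Basis.algebra
  then have "q ^ 2 * V * (b * N3 + q ^ 2 * b' * b * (N2 - A1 * b))
      - q ^ 3 * (q ^ 4 - 1) * u * q ^ 2 * b' * b * (b * T1 + N2 - A1 * b)
      - (q ^ 2 * b + u) * q ^ 2 * b' * (N2 * N2 - A1 * b * N2 - m * B0 * b * b) = 0"
    unfolding T2 T3 .
  moreover have "q ^ 2 * V * (b * N3 + q ^ 2 * b' * b * (N2 - A1 * b))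
      - q ^ 3 * (q ^ 4 - 1) * u * q ^ 2 * b' * b * (b * T1 + N2 - A1 * b)
      - (q ^ 2 * b + u) * q ^ 2 * b' * (N2 * N2 - A1 * b * N2 - m * B0 * b * b)
      = (y - 1) * w * p ^ 4 * q ^ 5 * m *
        (cub0 p q + cub1 p q * (p ^ 2 * y) - cub2 p q * (p ^ 2 * y) ^ 2 + cub3 p q * (p ^ 2 * y) ^ 3)"
    unfolding N3_def V_def N2_def u_def w_def b_def b'_def A1 B0 B1 m T1 cub0_def cub1_def cub2_def cub3_def
    by Groebner_Basis.algebra
  ultimately show ?thesis using nz w by auto
qed simp

text \<open>The \<open>s\<close> are the diagonal entries of \<open>S\<close>. \<open>e1\<close>,
  \<open>e2\<close>, \<open>e3\<close> are the entries (1, 0), (2, 0), (2, 1) of the commutation of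
  \<open>S P S\<close> with \<open>L\<close>, and \<open>e1'\<close> is the entry (1, 0) for
  \<open>T P T\<close>. Being homogeneous, they involve only ratios of consecutive entries;
  \<open>\<mu>\<close> is eliminated by \<open>e2\<close>, and \<open>\<sigma>\<close> by
  \<open>e1\<close> and \<open>e1'\<close>, which leaves two equations for
  \<open>\<rho>\<close>.\<close>

lemma modular_contradiction:
  fixes p q m B0 B1 B2 C2 A1 A2 T1 T2 T3 P22 s0 s1 s2 s3 :: "'a :: field"
  assumes m: "m = q * (q ^ 2 - 1)" and B0: "B0 = (q ^ 3 * p - 1) * (q ^ 3 * p - q)"
    and B1: "B1 = (q ^ 3 * p - q ^ 2) * (q ^ 3 * p - q ^ 3)"
    and B2: "B2 = (q ^ 3 * p - q ^ 4) * (q ^ 3 * p - q ^ 5)"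
    and C2: "C2 = (q ^ 4 - 1) * q ^ 3" and A1: "A1 = B0 - B1 - m" and A2: "A2 = B0 - B2 - C2"
    and T1: "T1 = q ^ 4 * p ^ 2 - (q + 1) * q ^ 3 * p + q"
    and r1: "B1 * T2 + m * B0 + A1 * T1 = T1 * T1"
    and r2: "B2 * T3 + C2 * T1 + A2 * T2 = T1 * T2"
    and g2: "m * B0 + A1 * T2 + C2 * (m * P22) = T2 * T2"
    and nz: "q \<noteq> 0" "p \<noteq> 0" "m \<noteq> 0" "B1 \<noteq> 0" "B2 \<noteq> 0" "q ^ 4 - 1 \<noteq> 0"
    and s: "s0 \<noteq> 0" "s1 \<noteq> 0" "s2 \<noteq> 0" "s3 \<noteq> 0"
    and e1: "B1 * (s2 * s0) + m * (s0 * s0) + A1 * (s1 * s0) = T1 * (s1 * s1)"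
    and e1': "B1 * (inverse s2 * inverse s0) + m * (inverse s0 * inverse s0) + A1 * (inverse s1 * inverse s0)
      = T1 * (inverse s1 * inverse s1)"
    and e2: "B2 * (s3 * s0) + C2 * (s1 * s0) + A2 * (s2 * s0) = T2 * (s2 * s1)"
    and e3: "B2 * (T3 * (s3 * s1)) + C2 * (T1 * (s1 * s1)) + A2 * (T2 * (s2 * s1))
      = m * B0 * (s2 * s0) + A1 * (T2 * (s2 * s1)) + C2 * (m * P22) * (s2 * s2)"
  shows False
proof -
  define \<rho> where "\<rho> = s1 / s0"
  define \<sigma> where "\<sigma> = s2 / s1"
  define \<mu> where "\<mu> = s3 / s2"
  have rs: "\<rho> \<noteq> 0" "\<sigma> \<noteq> 0" "\<mu> \<noteq> 0" using s by (auto simp: \<rho>_def \<sigma>_def \<mu>_def)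
  have s1: "s1 = \<rho> * s0" using s by (simp add: \<rho>_def)
  have s2: "s2 = \<sigma> * s1" using s by (simp add: \<sigma>_def)
  have s3: "s3 = \<mu> * s2" using s by (simp add: \<mu>_def)
  have T2: "T2 = q ^ 2 * p ^ 2 - (q + 1) * q ^ 3 * p + q"
  proof -
    have "B1 * T2 = B1 * (q ^ 2 * p ^ 2 - (q + 1) * q ^ 3 * p + q)"
      using r1 unfolding A1 B0 B1 m T1 by Groebner_Basis.algebra
    then show ?thesis using nz by simp
  qed
  have T3: "T3 = p ^ 2 - (q + 1) * q ^ 3 * p + q"
  proof -
    have "B2 * T3 = B2 * (p ^ 2 - (q + 1) * q ^ 3 * p + q)"
      using r2 unfolding A2 B0 B2 C2 T1 T2 by Groebner_Basis.algebra
    then show ?thesis using nz by simp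
  qed
  define G where "G = T2 * T2 - A1 * T2 - m * B0"
  have G: "C2 * (m * P22) = G" using g2 unfolding G_def by Groebner_Basis.algebra
  have "(s0 * s0 * \<rho>) * (B1 * \<sigma> * \<rho> + m + A1 * \<rho> - T1 * \<rho> * \<rho>) = 0"
    using e1 unfolding s2 s1 by Groebner_Basis.algebra
  then have "\<rho> * (B1 * \<sigma> * \<rho> + m + A1 * \<rho> - T1 * \<rho> * \<rho>) = 0" using s by simp
  then have f1: "B1 * \<sigma> * \<rho> = T1 * \<rho> * \<rho> - A1 * \<rho> - m" using rs by Groebner_Basis.algebra
  have "(\<rho> * (s0 * s0)) * (B1 * \<rho> + A1 * \<rho> * \<sigma> + m * \<rho> * \<rho> * \<sigma> - T1 * \<sigma>) = 0"
    using e1' s rs unfolding s2 s1 by (simp add: field_simps)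
  then have "B1 * \<rho> + A1 * \<rho> * \<sigma> + m * \<rho> * \<rho> * \<sigma> - T1 * \<sigma> = 0"
    using s rs by simp
  then have f1': "B1 * \<rho> = \<sigma> * (T1 - A1 * \<rho> - m * \<rho> * \<rho>)" by Groebner_Basis.algebra
  have "(s0 * s0 * \<rho>) * (B2 * \<mu> * \<sigma> + C2 + A2 * \<sigma> - T2 * \<rho> * \<sigma>) = 0"
    using e2 unfolding s3 s2 s1 by Groebner_Basis.algebra
  then have f2: "B2 * \<mu> * \<sigma> = T2 * \<rho> * \<sigma> - A2 * \<sigma> - C2" using s rs by simp Groebner_Basis.algebra
  have "(s0 * s0 * \<rho>) * (B2 * T3 * \<mu> * \<sigma> * \<rho> + C2 * T1 * \<rho> + A2 * T2 * \<sigma> * \<rho> -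
      (m * B0 * \<sigma> + A1 * T2 * \<sigma> * \<rho> + G * \<sigma> * \<sigma> * \<rho>)) = 0"
    using e3 unfolding G s3 s2 s1 by Groebner_Basis.algebra
  then have f3: "T3 * \<rho> * (B2 * \<mu> * \<sigma>) + C2 * T1 * \<rho> + A2 * T2 * \<sigma> * \<rho> =
      m * B0 * \<sigma> + A1 * T2 * \<sigma> * \<rho> + G * \<sigma> * \<sigma> * \<rho>" using s rs by simp Groebner_Basis.algebra
  have f4: "C2 * (T1 - T3) * \<rho> + \<sigma> * (T2 * T3 * \<rho> * \<rho> + (A2 * (T2 - T3) - A1 * T2) * \<rho> - m * B0 - G * \<sigma> * \<rho>) = 0"
    using f3 unfolding f2 by Groebner_Basis.algebra
  \<comment> \<open>\<open>f4\<close> is multiplied by \<open>B1\<close>: then \<open>f1'\<close>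
    makes its first term a multiple of \<open>\<sigma>\<close>, and \<open>f1\<close> removes the
    inner \<open>\<sigma>\<close>. Cancelling \<open>\<sigma>\<close> leaves a quadratic in
    \<open>\<rho>\<close>.\<close>
  have "\<sigma> * (C2 * (T1 - T3) * (T1 - A1 * \<rho> - m * \<rho> * \<rho>) + B1 * T2 * T3 * \<rho> * \<rho>
      + B1 * (A2 * (T2 - T3) - A1 * T2) * \<rho> - m * B0 * B1 - G * (T1 * \<rho> * \<rho> - A1 * \<rho> - m)) = 0"
    using f4 f1 f1' by Groebner_Basis.algebra
  then have f5: "C2 * (T1 - T3) * (T1 - A1 * \<rho> - m * \<rho> * \<rho>) + B1 * T2 * T3 * \<rho> * \<rho>
      + B1 * (A2 * (T2 - T3) - A1 * T2) * \<rho> - m * B0 * B1 - G * (T1 * \<rho> * \<rho> - A1 * \<rho> - m) = 0"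
    using rs by simp
  \<comment> \<open>The equation \<open>f5\<close> is linear in \<open>\<rho> + 1 / \<rho>\<close> because the coefficients of \<open>\<rho>\<close> and \<open>1 / \<rho>\<close> agree.\<close>
  define a where "a = p ^ 2 * q - q ^ 2 - 1"
  define g where "g = p ^ 2 * q ^ 5 + 2 * p ^ 2 * q ^ 3 + 2 * p ^ 2 * q - p ^ 3 * q ^ 4 - p ^ 3 * q ^ 3 - 2 * q ^ 2 - 2"
  define f where "f = p ^ 2 * q * m ^ 2 * (q ^ 4 - 1)"
  have f: "f \<noteq> 0" using nz by (simp add: f_def)
  have k1: "B1 * T2 * T3 - C2 * (T1 - T3) * m - G * T1 = f * q * a"
    unfolding G_def A1 B0 B1 C2 m T1 T2 T3 f_def a_def by Groebner_Basis.algebra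
  have k2: "C2 * (T1 - T3) * T1 - m * B0 * B1 + G * m = f * q * a"
    unfolding G_def A1 B0 B1 C2 m T1 T2 T3 f_def a_def by Groebner_Basis.algebra
  have k3: "C2 * (T1 - T3) * A1 - B1 * (A2 * (T2 - T3) - A1 * T2) - G * A1 = f * q * g"
    unfolding G_def A1 A2 B0 B1 B2 C2 m T1 T2 T3 f_def g_def by Groebner_Basis.algebra
  have "f * q * (a * (\<rho> * \<rho> + 1) - g * \<rho>) = 0"
    using f5 k1 k2 k3 by Groebner_Basis.algebra
  then have lin: "a * (\<rho> * \<rho> + 1) = g * \<rho>" using f nz by simp
  \<comment> \<open>The product of \<open>f1\<close> and \<open>f1'\<close> has the common factor
    \<open>\<sigma>\<close>; what remains is a palindromic quartic in \<open>\<rho>\<close>, that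
    is, a quadratic in \<open>\<rho> + 1 / \<rho>\<close>.\<close>
  have "(T1 * \<rho> * \<rho> - A1 * \<rho> - m) * (\<sigma> * (T1 - A1 * \<rho> - m * \<rho> * \<rho>)) = (B1 * \<sigma> * \<rho>) * (B1 * \<rho>)"
    using f1 f1' by simp
  then have "\<sigma> * ((T1 * \<rho> * \<rho> - A1 * \<rho> - m) * (T1 - A1 * \<rho> - m * \<rho> * \<rho>) - B1 * B1 * \<rho> * \<rho>) = 0"
    by Groebner_Basis.algebra
  then have quad: "T1 * m * (\<rho> * \<rho> + 1) * (\<rho> * \<rho> + 1) + A1 * (T1 - m) * (\<rho> * \<rho> + 1) * \<rho>
      - ((T1 + m) * (T1 + m) + A1 * A1 - B1 * B1) * \<rho> * \<rho> = 0"
    using rs by simp Groebner_Basis.algebra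
  \<comment> \<open>Multiplying \<open>quad\<close> by \<open>a * a\<close> before substituting
    \<open>lin\<close> avoids a division by \<open>a\<close>.\<close>
  have "\<rho> * \<rho> * (T1 * m * g * g + A1 * (T1 - m) * g * a - ((T1 + m) * (T1 + m) + A1 * A1 - B1 * B1) * a * a) = 0"
    using quad lin by Groebner_Basis.algebra
  then have "T1 * m * g * g + A1 * (T1 - m) * g * a - ((T1 + m) * (T1 + m) + A1 * A1 - B1 * B1) * a * a = 0"
    using rs by simp
  \<comment> \<open>The resultant. For \<open>p = q^(n-3)\<close> the factor \<open>B2\<close> is
    the one that vanishes at \<open>n = 4\<close> and \<open>n = 5\<close>.\<close>
  moreover have "q ^ 9 * (T1 * m * g * g + A1 * (T1 - m) * g * a - ((T1 + m) * (T1 + m) + A1 * A1 - B1 * B1) * a * a)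
      = p ^ 2 * (q ^ 2 + 1) * m * B1 * B1 * B2"
    unfolding A1 B0 B1 B2 m T1 g_def a_def by Groebner_Basis.algebra
  moreover have "q ^ 2 + 1 \<noteq> 0"
  proof
    assume "q ^ 2 + 1 = 0"
    then have "q ^ 4 - 1 = 0" by Groebner_Basis.algebra
    then show False using nz by simp
  qed
  ultimately show False using nz by auto
qed

subsection \<open>Solutions of the matrix equation\<close>

text \<open>
  The hypothesis \<open>(P T)\<^sup>3 = 1\<close> and \<open>P\<^sup>2 = N 1\<close> give \<open>S P S = N P T P\<close> and
  \<open>P S P = N\<^sup>2 T P T\<close>, where \<open>S\<close> is the inverse of \<open>T\<close>; conjugation by \<open>P\<close> exchanges
  \<open>L\<close> with a diagonal matrix, which commutes with \<open>S\<close> and \<open>T\<close>.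
\<close>

lemma modular_commute:
  fixes P T S L G :: "complex mat" and N :: complex
  assumes C: "P \<in> carrier_mat D D" "T \<in> carrier_mat D D" "S \<in> carrier_mat D D"
      "L \<in> carrier_mat D D" "G \<in> carrier_mat D D"
    and PP: "P * P = N \<cdot>\<^sub>m 1\<^sub>m D" and N: "N \<noteq> 0" and LP: "L * P = P * G"
    and G: "G * T = T * G" "G * S = S * G" and TS: "T * S = 1\<^sub>m D" "S * T = 1\<^sub>m D"
    and PT: "(P * T) ^\<^sub>m 3 = 1\<^sub>m D"
  shows "G * P = P * L" "L * (S * P * S) = S * P * S * L" "L * (T * P * T) = T * P * T * L"
proof -
  have mc: "A * B \<in> carrier_mat D D" if "A \<in> carrier_mat D D" "B \<in> carrier_mat D D" for A B :: "complex mat"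
    using that by (rule mult_carrier_mat)
  have asc: "A * B * Z = A * (B * Z)"
    if "A \<in> carrier_mat D D" "B \<in> carrier_mat D D" "Z \<in> carrier_mat D D" for A B Z :: "complex mat"
    using that by (rule assoc_mult_mat)
  have sl: "(c \<cdot>\<^sub>m A) * B = c \<cdot>\<^sub>m (A * B)" and sr: "A * (c \<cdot>\<^sub>m B) = c \<cdot>\<^sub>m (A * B)"
    if "A \<in> carrier_mat D D" "B \<in> carrier_mat D D" for A B :: "complex mat" and c
    using that by (auto intro: mult_smult_assoc_mat mult_smult_distrib)
  have one: "1\<^sub>m D * A = A" "A * 1\<^sub>m D = A" if "A \<in> carrier_mat D D" for A :: "complex mat"
    using that by auto
  have canc: "A = B" if "N \<cdot>\<^sub>m A = N \<cdot>\<^sub>m B" "A \<in> carrier_mat D D" "B \<in> carrier_mat D D" for A B :: "complex mat"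
  proof (rule eq_matI)
    fix i j assume "i < dim_row B" "j < dim_col B"
    then show "A $$ (i, j) = B $$ (i, j)"
      using arg_cong[OF that(1), of "\<lambda>M. M $$ (i, j)"] that(2,3) N by auto
  qed (use that in auto)
  have PPl: "P * (P * A) = N \<cdot>\<^sub>m A" if "A \<in> carrier_mat D D" for A
    using asc[of P P A] PP C that by (simp add: sl one)
  have TSl: "T * (S * A) = A" "S * (T * A) = A" if "A \<in> carrier_mat D D" for A
    using asc[of T S A] asc[of S T A] TS C that by (simp_all add: one)
  have LPl: "L * (P * A) = P * (G * A)" if "A \<in> carrier_mat D D" for A
    using asc[of L P A] asc[of P G A] LP C that by simp
  show GP: "G * P = P * L"
  proof -
    \<comment> \<open>The dual relation comes from multiplying \<open>LP\<close> by \<open>P\<close>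
      on both sides and cancelling the scalar \<open>N\<close>.\<close>
    have "P * (L * (P * P)) = P * (P * (G * P))" using C by (simp add: LPl mc)
    then have "N \<cdot>\<^sub>m (P * L) = N \<cdot>\<^sub>m (G * P)" using C by (simp add: PP PPl mc sr one)
    then show ?thesis using canc C mc by metis
  qed
  have GTl: "G * (T * A) = T * (G * A)" "G * (S * A) = S * (G * A)" if "A \<in> carrier_mat D D" for A
    using asc[of G T A] asc[of T G A] asc[of G S A] asc[of S G A] G C that by simp_all
  have GPl: "G * (P * A) = P * (L * A)" if "A \<in> carrier_mat D D" for A
    using asc[of G P A] asc[of P L A] GP C that by simp
  have six: "P * (T * (P * (T * (P * T)))) = 1\<^sub>m D"
    using PT C by (simp add: numeral_3_eq_3 asc mc one)
  have sixl: "P * (T * (P * (T * (P * (T * A))))) = A" if "A \<in> carrier_mat D D" for A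
  proof -
    have "P * (T * (P * (T * (P * (T * A))))) = P * (T * (P * (T * (P * T)))) * A"
      using C that by (simp add: asc mc)
    then show ?thesis unfolding six using that by (simp add: one)
  qed
  have e1: "S * (P * S) = N \<cdot>\<^sub>m (P * (T * P))"
  proof -
    have "S * (P * S) = P * (T * (P * (T * (P * (T * (S * (P * S)))))))"
      using C by (simp add: sixl mc)
    also have "\<dots> = N \<cdot>\<^sub>m (P * (T * (P * (T * S))))"
      using C by (simp add: TSl PPl mc sr)
    also have "\<dots> = N \<cdot>\<^sub>m (P * (T * P))" using C by (simp add: TS one)
    finally show ?thesis .
  qed
  have e2: "P * (S * P) = N \<cdot>\<^sub>m (N \<cdot>\<^sub>m (T * (P * T)))"
  proof -
    have "P * (S * P) = P * (S * P) * (P * (T * (P * (T * (P * T)))))"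
      using C by (simp add: six one mc)
    also have "\<dots> = N \<cdot>\<^sub>m (N \<cdot>\<^sub>m (T * (P * T)))"
      using C by (simp add: asc mc PPl sr TSl)
    finally show ?thesis .
  qed
  have "N \<cdot>\<^sub>m (L * (P * (T * P))) = N \<cdot>\<^sub>m (P * (T * (P * L)))"
    using C by (simp add: LPl GTl GP mc)
  then have "L * (S * (P * S)) = S * (P * S) * L"
    unfolding e1 using C by (simp add: sl sr asc mc)
  then show "L * (S * P * S) = S * P * S * L" using C by (simp add: asc mc)
  have "L * (P * (S * P)) = P * (S * P) * L"
    using C by (simp add: LPl GTl GP mc asc)
  then have "N \<cdot>\<^sub>m (N \<cdot>\<^sub>m (L * (T * (P * T)))) = N \<cdot>\<^sub>m (N \<cdot>\<^sub>m (T * (P * T) * L))"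
    unfolding e2 using C by (simp add: sl sr mc)
  then have "N \<cdot>\<^sub>m (L * (T * (P * T))) = N \<cdot>\<^sub>m (T * (P * T) * L)"
    by (rule canc) (simp_all add: C mc)
  then have "L * (T * (P * T)) = T * (P * T) * L"
    by (rule canc) (simp_all add: C mc)
  then show "L * (T * P * T) = T * P * T * L" using C by (simp add: asc mc)
qed

lemma diag_mult_index:
  fixes A W :: "'b :: comm_ring_1 mat"
  assumes A: "A \<in> carrier_mat D D" and W: "W \<in> carrier_mat D D" "diagonal_mat W" and ij: "i < D" "j < D"
  shows "(W * A) $$ (i, j) = W $$ (i, i) * A $$ (i, j)" "(A * W) $$ (i, j) = A $$ (i, j) * W $$ (j, j)"
proof -
  have "(W * A) $$ (i, j) = (\<Sum>k<D. W $$ (i, k) * A $$ (k, j))"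
    using A W ij by (simp add: scalar_prod_def lessThan_atLeast0)
  also have "\<dots> = (\<Sum>k<D. if k = i then W $$ (i, i) * A $$ (i, j) else 0)"
    using W ij by (intro sum.cong) (auto simp: diagonal_mat_def)
  also have "\<dots> = W $$ (i, i) * A $$ (i, j)" using ij by (subst sum.delta) auto
  finally show "(W * A) $$ (i, j) = W $$ (i, i) * A $$ (i, j)" .
  have "(A * W) $$ (i, j) = (\<Sum>k<D. A $$ (i, k) * W $$ (k, j))"
    using A W ij by (simp add: scalar_prod_def lessThan_atLeast0)
  also have "\<dots> = (\<Sum>k<D. if k = j then A $$ (i, j) * W $$ (j, j) else 0)"
    using W ij by (intro sum.cong) (auto simp: diagonal_mat_def)
  also have "\<dots> = A $$ (i, j) * W $$ (j, j)" using ij by (subst sum.delta) auto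
  finally show "(A * W) $$ (i, j) = A $$ (i, j) * W $$ (j, j)" .
qed

lemma diag_commute:
  fixes A B :: "'b :: comm_ring_1 mat"
  assumes "A \<in> carrier_mat D D" "diagonal_mat A" "B \<in> carrier_mat D D" "diagonal_mat B"
  shows "A * B = B * A"
proof (rule eq_matI)
  fix i j assume "i < dim_row (B * A)" "j < dim_col (B * A)"
  then have ij: "i < D" "j < D" using assms by auto
  show "(A * B) $$ (i, j) = (B * A) $$ (i, j)"
    using diag_mult_index(1)[OF assms(3,1,2) ij] diag_mult_index(2)[OF assms(3,1,2) ij] assms ij
    by (cases "i = j") (auto simp: diagonal_mat_def)
qed (use assms in auto)

section \<open>Entrywise form of the matrix relations\<close>

context alt_eigen
begin

definition "L = mat (d + 1) (d + 1)
  (\<lambda>(i, j). if j = i + 1 then b i else if j = i then a i else if j + 1 = i then c i else 0)"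

definition "G = mat (d + 1) (d + 1) (\<lambda>(i, j). if i = j then m * P $$ (i, 1) else 0)"

lemma carriers: "P \<in> carrier_mat (d + 1) (d + 1)" "L \<in> carrier_mat (d + 1) (d + 1)"
    "G \<in> carrier_mat (d + 1) (d + 1)" "diagonal_mat G"
  using fe by (auto simp: first_eigenmatrix_def L_def G_def diagonal_mat_def)

lemma c_0: "c 0 = 0" and a_0: "a 0 = 0" and c_1: "c 1 = m"
  by (simp_all add: c_def a_def)

text \<open>The parity of \<open>n\<close> decides which of the two factors vanishes.\<close>

lemma b_d: "b d = 0"
proof -
  have "n = 2 * d \<or> n = 2 * d + 1" using d by presburger
  then show ?thesis by (auto simp: b_def)
qed

text \<open>The truncated index \<open>i - 1\<close> at \<open>i = 0\<close> is harmless because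
  \<open>c 0 = 0\<close>; the term at \<open>d + 1\<close> is absent because the sum stops at
  \<open>d\<close>.\<close>

lemma row_sum:
  assumes i: "i \<le> d"
  shows "(\<Sum>k<d + 1. L $$ (i, k) * f k) =
    (if i < d then b i * f (i + 1) else 0) + c i * f (i - 1) + a i * f i"
proof -
  have "(\<Sum>k<d + 1. L $$ (i, k) * f k) = (\<Sum>k<d + 1. (if k = i + 1 then b i * f (i + 1) else 0)
      + (if k = i - 1 then c i * f (i - 1) else 0) + (if k = i then a i * f i else 0))"
    using i by (intro sum.cong) (auto simp: L_def c_0)
  also have "\<dots> = (if i < d then b i * f (i + 1) else 0) + c i * f (i - 1) + a i * f i"
    using i by (simp only: sum.distrib sum.delta finite_lessThan lessThan_iff) auto
  finally show ?thesis .
qed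

text \<open>Unlike \<open>c 0\<close>, the number \<open>b 0\<close> is not 0, so the truncated
  index \<open>j - 1\<close> at \<open>j = 0\<close> needs its own case.\<close>

lemma col_sum:
  assumes j: "j < d"
  shows "(\<Sum>k<d + 1. f k * L $$ (k, j)) =
    (if j = 0 then 0 else f (j - 1) * b (j - 1)) + f (j + 1) * c (j + 1) + f j * a j"
proof -
  have "(\<Sum>k<d + 1. f k * L $$ (k, j)) = (\<Sum>k<d + 1. (if k = j - 1 then (if j = 0 then 0 else f (j - 1) * b (j - 1)) else 0)
      + (if k = j + 1 then f (j + 1) * c (j + 1) else 0) + (if k = j then f j * a j else 0))"
    using j by (intro sum.cong) (auto simp: L_def)
  also have "\<dots> = (if j = 0 then 0 else f (j - 1) * b (j - 1)) + f (j + 1) * c (j + 1) + f j * a j"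
    using j by (simp only: sum.distrib sum.delta finite_lessThan lessThan_iff) auto
  finally show ?thesis .
qed

lemma mult_index:
  assumes "A \<in> carrier_mat (d + 1) (d + 1)" "B \<in> carrier_mat (d + 1) (d + 1)" "i \<le> d" "j \<le> d"
  shows "(A * B) $$ (i, j) = (\<Sum>k<d + 1. A $$ (i, k) * B $$ (k, j))"
  using assms by (simp add: scalar_prod_def lessThan_atLeast0)

lemma PP: "P * P = of_nat (card X) \<cdot>\<^sub>m 1\<^sub>m (d + 1)"
proof (rule eq_matI)
  fix i j assume "i < dim_row (of_nat (card X) \<cdot>\<^sub>m 1\<^sub>m (d + 1) :: complex mat)"
    "j < dim_col (of_nat (card X) \<cdot>\<^sub>m 1\<^sub>m (d + 1) :: complex mat)"
  then have ij: "i \<le> d" "j \<le> d" by auto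
  have "(P * P) $$ (i, j) = (\<Sum>k\<le>d. P $$ (i, k) * P $$ (k, j))"
    unfolding mult_index[OF carriers(1,1) ij] by (simp add: lessThan_Suc_atMost)
  then show "(P * P) $$ (i, j) = (of_nat (card X) \<cdot>\<^sub>m 1\<^sub>m (d + 1)) $$ (i, j)"
    using P_square[OF ij] ij by auto
qed (use carriers in auto)

lemma LP: "L * P = P * G"
proof (rule eq_matI)
  fix i j assume "i < dim_row (P * G)" "j < dim_col (P * G)"
  then have ij: "i \<le> d" "j \<le> d" using carriers by auto
  have "(L * P) $$ (i, j) = b i * P $$ (i + 1, j) + c i * P $$ (i - 1, j) + a i * P $$ (i, j)"
    unfolding mult_index[OF carriers(2,1) ij] row_sum[OF ij(1)] using b_d ij by auto
  also have "\<dots> = (P * G) $$ (i, j)"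
    using P_row[OF ij] diag_mult_index(2)[OF carriers(1,3,4), of i j] ij by (simp add: G_def)
  finally show "(L * P) $$ (i, j) = (P * G) $$ (i, j)" .
qed (use carriers in auto)

end

context alt_eigen
begin

text \<open>Meant for \<open>W = S\<close> and \<open>W = T\<close>; the entry of
  \<open>W * P * W\<close> at \<open>(i, j)\<close> is
  \<open>w i * P $$ (i, j) * w j\<close>.\<close>

lemma diag_conj_entry:
  assumes W: "W \<in> carrier_mat (d + 1) (d + 1)" "diagonal_mat W"
    and comm: "L * (W * P * W) = W * P * W * L" and ij: "i \<le> d" "j < d"
  defines "w \<equiv> \<lambda>i. W $$ (i, i)"
  shows "(if i < d then b i * (w (i + 1) * P $$ (i + 1, j) * w j) else 0)
      + c i * (w (i - 1) * P $$ (i - 1, j) * w j) + a i * (w i * P $$ (i, j) * w j) =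
    (if j = 0 then 0 else w i * P $$ (i, j - 1) * w (j - 1) * b (j - 1))
      + w i * P $$ (i, j + 1) * w (j + 1) * c (j + 1) + w i * P $$ (i, j) * w j * a j"
proof -
  note C = carriers
  have M: "W * P * W \<in> carrier_mat (d + 1) (d + 1)" using W C by auto
  have e: "(W * P * W) $$ (i, j) = w i * P $$ (i, j) * w j" if "i \<le> d" "j \<le> d" for i j
    using that diag_mult_index(1)[OF C(1) W, of i j] W C
    by (subst diag_mult_index(2)[OF _ W]) (auto simp: w_def)
  have "(L * (W * P * W)) $$ (i, j) = (\<Sum>k<d + 1. L $$ (i, k) * (w k * P $$ (k, j) * w j))"
    using ij by (subst mult_index[OF C(2) M]) (auto simp: e intro!: sum.cong)
  moreover have "(W * P * W * L) $$ (i, j) = (\<Sum>k<d + 1. w i * P $$ (i, k) * w k * L $$ (k, j))"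
    using ij by (subst mult_index[OF M C(2)]) (auto simp: e intro!: sum.cong)
  ultimately show ?thesis unfolding comm row_sum[OF ij(1)] col_sum[OF ij(2)] by simp
qed

text \<open>Column 1 of the dual relation: it expresses the entries of column 2 of \<open>P\<close>
  by those of column 1.\<close>

lemma P_col:
  assumes GP: "G * P = P * L" and k: "k \<le> d" and d2: "d \<ge> 2"
  shows "m * P $$ (k, 1) * P $$ (k, 1) = b 0 + P $$ (k, 2) * c 2 + P $$ (k, 1) * a 1"
proof -
  have "(G * P) $$ (k, 1) = m * P $$ (k, 1) * P $$ (k, 1)"
    using diag_mult_index(1)[OF carriers(1,3,4), of k 1] k d2 by (simp add: G_def)
  moreover have "(P * L) $$ (k, 1) = P $$ (k, 0) * b 0 + P $$ (k, 2) * c 2 + P $$ (k, 1) * a 1"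
    using k d2 col_sum[of 1 "\<lambda>i. P $$ (k, i)"] by (subst mult_index[OF carriers(1,2)]) (auto simp: numeral_2_eq_2)
  ultimately show ?thesis using GP P_0[OF k] by simp
qed

lemma valency: "m * P $$ (0, 1) = b 0"
  using P_row[of 0 0] P_0 d1 by (simp add: c_0 a_0)

text \<open>Excludes the root \<open>y = q ^ 2\<close>. If the two entries agreed, the recurrence
  would make column 1 constant, hence proportional to column 0, which is all ones. As
  \<open>P\<close> squared is a nonzero scalar matrix, column 1 would then be 0, contrary to
  \<open>b 0 \<noteq> 0\<close>.\<close>

lemma eigenvalue_ne_valency: "P $$ (1, 1) \<noteq> P $$ (0, 1)"
proof
  assume eq: "P $$ (1, 1) = P $$ (0, 1)"
  have all: "i + 1 \<le> d \<Longrightarrow> P $$ (i, 1) = P $$ (0, 1) \<and> P $$ (i + 1, 1) = P $$ (0, 1)" for i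
  proof (induction i)
    case 0
    then show ?case using eq by simp
  next
    case (Suc i)
    then have 1: "P $$ (i, 1) = P $$ (0, 1)" "P $$ (i + 1, 1) = P $$ (0, 1)" by auto
    have "b (i + 1) * P $$ (i + 2, 1) + c (i + 1) * P $$ (0, 1) + a (i + 1) * P $$ (0, 1) = b 0 * P $$ (0, 1)"
      using P_row[of "i + 1" 1] Suc.prems 1 eq valency by simp
    then have "b (i + 1) * P $$ (i + 2, 1) = b (i + 1) * P $$ (0, 1)"
      by (simp add: a_def algebra_simps)
    moreover have "2 * d \<le> n" using d by simp
    then have "2 * (i + 1) + 1 < n" using Suc.prems by simp
    then have "b (i + 1) \<noteq> 0" by (rule b_nonzero)
    ultimately show ?case using 1 by simp
  qed
  have const: "P $$ (k, 1) = P $$ (0, 1)" if "k \<le> d" for k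
    using all[of "k - 1"] that d1 by (cases k) auto
  have "(\<Sum>k\<le>d. P $$ (0, k) * P $$ (k, 1)) = (\<Sum>k\<le>d. P $$ (0, 1) * (P $$ (0, k) * P $$ (k, 0)))"
  proof (rule sum.cong[OF refl])
    fix k assume "k \<in> {..d}"
    then have k: "k \<le> d" by simp
    show "P $$ (0, k) * P $$ (k, 1) = P $$ (0, 1) * (P $$ (0, k) * P $$ (k, 0))"
      unfolding const[OF k] P_0[OF k] by simp
  qed
  also have "\<dots> = P $$ (0, 1) * (\<Sum>k\<le>d. P $$ (0, k) * P $$ (k, 0))"
    by (rule sum_distrib_left[symmetric])
  finally have "P $$ (0, 1) = 0" using P_square[of 0 1] P_square[of 0 0] d1 X_pos by simp
  then have "b 0 = 0" using valency by simp
  moreover have "b 0 \<noteq> 0" using d d1 by (intro b_nonzero) linarith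
  ultimately show False by simp
qed

theorem no_modular_diagonal:
  assumes n: "n > 5" and T: "T \<in> carrier_mat (d + 1) (d + 1)" "diagonal_mat T"
    and PT: "(P * T) ^\<^sub>m 3 = 1\<^sub>m (d + 1)"
  shows False
proof -
  note C = carriers
  have d3: "d \<ge> 3" using n d by linarith
  define t where "t i = T $$ (i, i)" for i
  \<comment> \<open>\<open>P T P T P\<close> is a left inverse of \<open>T\<close>, so no diagonal
    entry of \<open>T\<close> is 0.\<close>
  have t: "t i \<noteq> 0" if "i \<le> d" for i
  proof -
    let ?Y = "P * T * (P * T) * P"
    have Y: "?Y \<in> carrier_mat (d + 1) (d + 1)" using C T by auto
    have "P * T * (P * T) \<in> carrier_mat (d + 1) (d + 1)" using C T by auto
    then have "?Y * T = 1\<^sub>m (d + 1)"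
      using PT C T assoc_mult_mat[of "P * T * (P * T)" "d + 1" "d + 1" P "d + 1" T "d + 1"]
      by (simp add: numeral_3_eq_3)
    then have "?Y $$ (i, i) * t i = 1"
      using diag_mult_index(2)[OF Y T, of i i] that by (simp add: t_def)
    then show ?thesis by auto
  qed
  define S where "S = mat (d + 1) (d + 1) (\<lambda>(i, j). if i = j then inverse (t i) else 0)"
  have S: "S \<in> carrier_mat (d + 1) (d + 1)" "diagonal_mat S"
    by (auto simp: S_def diagonal_mat_def)
  have TS: "T * S = 1\<^sub>m (d + 1)"
  proof (rule eq_matI)
    fix i j assume "i < dim_row (1\<^sub>m (d + 1) :: complex mat)" "j < dim_col (1\<^sub>m (d + 1) :: complex mat)"
    then have ij: "i < d + 1" "j < d + 1" by auto
    then show "(T * S) $$ (i, j) = 1\<^sub>m (d + 1) $$ (i, j)"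
      using diag_mult_index(1)[OF S(1) T ij] t[of i] by (auto simp: S_def t_def)
  qed (use S T in auto)
  have ST: "S * T = 1\<^sub>m (d + 1)" using TS diag_commute[OF S T] by simp
  have N: "of_nat (card X) \<noteq> (0 :: complex)" using X_pos by simp
  have comm: "G * P = P * L" "L * (S * P * S) = S * P * S * L" "L * (T * P * T) = T * P * T * L"
    using modular_commute[OF C(1) T(1) S(1) C(2,3) PP N LP diag_commute[OF C(3,4) T]
        diag_commute[OF C(3,4) S] TS ST PT] by blast+
  define s where "s i = inverse (t i)" for i
  have Ss: "S $$ (i, i) = s i" if "i \<le> d" for i using that by (simp add: S_def s_def)
  have s: "s i \<noteq> 0" "inverse (s i) = t i" if "i \<le> d" for i using t[OF that] by (auto simp: s_def)

  define p where "p = q ^ (n - 3)"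
  have Q: "q ^ n = q ^ 3 * p" using n unfolding p_def by (simp flip: power_add)
  have q0: "q \<noteq> 0" by (simp add: q)
  then have p0: "p \<noteq> 0" by (simp add: p_def)
  have q2: "CARD('a) \<ge> 2" by (rule card_field_ge_2)
  have "(1 :: nat) < CARD('a) ^ k" if "k > 0" for k using q2 that by (intro one_less_power) auto
  then have "of_nat (CARD('a) ^ k) \<noteq> (of_nat 1 :: complex)" if "k > 0" for k
    unfolding of_nat_eq_iff using that by (metis less_irrefl)
  then have qk: "q ^ k - 1 \<noteq> 0" if "k > 0" for k using that by (simp add: q)
  have m0: "m \<noteq> 0" using q0 qk[of 2] by simp
  have b0: "b 0 = (q ^ 3 * p - 1) * (q ^ 3 * p - q)"
    and b1: "b 1 = (q ^ 3 * p - q ^ 2) * (q ^ 3 * p - q ^ 3)"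
    and b2: "b 2 = (q ^ 3 * p - q ^ 4) * (q ^ 3 * p - q ^ 5)"
    and c2: "c 2 = (q ^ 4 - 1) * q ^ 3"
    by (simp_all add: b_def c_def Q)
  have a1: "a 1 = b 0 - b 1 - m" and a2: "a 2 = b 0 - b 2 - c 2"
    using c_1 by (simp_all add: a_def)
  have bnz: "b 1 \<noteq> 0" "b 2 \<noteq> 0" using n by (intro b_nonzero; simp)+
  define \<theta> where "\<theta> i = m * P $$ (i, 1)" for i
  have r1: "b 1 * \<theta> 2 + m * b 0 + a 1 * \<theta> 1 = \<theta> 1 * \<theta> 1"
  proof -
    have "b 1 * P $$ (2, 1) + m * P $$ (0, 1) + a 1 * P $$ (1, 1) = m * P $$ (1, 1) * P $$ (1, 1)"
      using P_row[of 1 1] d3 c_1 by (simp add: numeral_2_eq_2)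
    moreover have "\<beta> * (M * x2) + M * (M * x0) + \<alpha> * (M * x1) = M * x1 * (M * x1)"
      if "\<beta> * x2 + M * x0 + \<alpha> * x1 = M * x1 * x1" for \<alpha> \<beta> M x0 x1 x2 :: complex
      using arg_cong[OF that, of "\<lambda>x. M * x"] by (simp add: algebra_simps)
    ultimately show ?thesis unfolding \<theta>_def valency[symmetric] by blast
  qed
  have row2: "b 2 * P $$ (3, k) + c 2 * P $$ (1, k) + a 2 * P $$ (2, k) = \<theta> k * P $$ (2, k)" if "k \<le> d" for k
    using P_row[of 2 k] d3 that by (simp add: \<theta>_def numeral_3_eq_3 numeral_2_eq_2)
  have r2: "b 2 * \<theta> 3 + c 2 * \<theta> 1 + a 2 * \<theta> 2 = \<theta> 1 * \<theta> 2"
  proof -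
    have "b 2 * P $$ (3, 1) + c 2 * P $$ (1, 1) + a 2 * P $$ (2, 1) = m * P $$ (1, 1) * P $$ (2, 1)"
      using row2[of 1] d3 by (simp add: \<theta>_def)
    moreover have "\<beta> * (M * x3) + \<gamma> * (M * x1) + \<alpha> * (M * x2) = M * x1 * (M * x2)"
      if "\<beta> * x3 + \<gamma> * x1 + \<alpha> * x2 = M * x1 * x2" for \<alpha> \<beta> \<gamma> M x1 x2 x3 :: complex
      using arg_cong[OF that, of "\<lambda>x. M * x"] by (simp add: algebra_simps)
    ultimately show ?thesis unfolding \<theta>_def by blast
  qed
  have g: "m * b 0 + a 1 * \<theta> k + c 2 * (m * P $$ (k, 2)) = \<theta> k * \<theta> k" if "k \<le> d" for k
  proof -
    have "m * P $$ (k, 1) * P $$ (k, 1) = b 0 + P $$ (k, 2) * c 2 + P $$ (k, 1) * a 1"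
      using P_col[OF comm(1) that] d3 by simp
    moreover have "M * \<beta> + \<alpha> * (M * x) + \<gamma> * (M * z) = M * x * (M * x)"
      if "M * x * x = \<beta> + z * \<gamma> + x * \<alpha>" for \<alpha> \<beta> \<gamma> M x z :: complex
      using arg_cong[OF that, of "\<lambda>x. M * x"] by (simp add: algebra_simps)
    ultimately show ?thesis unfolding \<theta>_def by blast
  qed
  obtain \<rho> where \<rho>: "\<rho> \<ge> 0" "\<theta> 1 + q ^ (2 * n) - b 0 = complex_of_real \<rho>"
    using eigenvalue_nonneg[of 1] d1 unfolding \<theta>_def by blast
  have Q2: "q ^ (2 * n) = (q ^ 3 * p) ^ 2" unfolding Q[symmetric] by (simp add: power_mult mult.commute)
  \<comment> \<open>\<open>q^4 p^2\<close> is \<open>q^(2n-2)\<close>, so \<open>y\<close> is the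
    normalized eigenvalue of the translation sum: constant functions have the eigenvalue
    \<open>q^(2n)\<close>, that is \<open>y = q^2\<close>, and the standard ordering gives
    \<open>y = 1\<close>.\<close>
  define y where "y = complex_of_real \<rho> / (q ^ 4 * p ^ 2)"
  have y: "q ^ 4 * p ^ 2 * y = complex_of_real \<rho>" using q0 p0 by (simp add: y_def)
  have th1: "\<theta> 1 = q ^ 4 * p ^ 2 * y - (q + 1) * q ^ 3 * p + q"
    unfolding y \<rho>(2)[symmetric] Q2 b0 by (simp add: algebra_simps power2_eq_square)
  have "y = q ^ 2 \<or> y = 1 \<or>
      cub0 p q + cub1 p q * (p ^ 2 * y) - cub2 p q * (p ^ 2 * y) ^ 2 + cub3 p q * (p ^ 2 * y) ^ 3 = 0"
    using eigenvalue_cases[OF refl b0 b1 b2 c2 a1 a2 th1 r1 r2 g g g row2 q0 p0 m0 bnz] d3 by simp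
  moreover have "y \<noteq> q ^ 2"
  proof
    assume "y = q ^ 2"
    then have "\<theta> 1 = b 0" unfolding th1 b0 by (simp add: algebra_simps power_def)
    then have "m * P $$ (1, 1) = m * P $$ (0, 1)" unfolding \<theta>_def valency .
    then show False using m0 eigenvalue_ne_valency by simp
  qed
  moreover have "cub0 p q + cub1 p q * (p ^ 2 * y) - cub2 p q * (p ^ 2 * y) ^ 2 + cub3 p q * (p ^ 2 * y) ^ 3 \<noteq> 0"
  proof -
    define r where "r = real CARD('a)"
    define p' where "p' = r ^ (n - 3)"
    define z where "z = \<rho> / r ^ 4"
    have r: "r \<ge> 2" using q2 by (simp add: r_def)
    have "p' \<ge> r ^ 3" unfolding p'_def using r n by (intro power_increasing) auto
    moreover have "z \<ge> 0" using \<rho> r by (simp add: z_def)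
    ultimately have pos: "cub0 p' r + cub1 p' r * z - cub2 p' r * z ^ 2 + cub3 p' r * z ^ 3 > 0"
      using r by (intro cubic_pos)
    have qr: "q = complex_of_real r" by (simp add: q r_def)
    have pr: "p = complex_of_real p'" by (simp add: p_def p'_def qr)
    have yz: "p ^ 2 * y = complex_of_real z"
      using p0 q0 by (simp add: y_def z_def flip: qr)
    have "cub0 p q + cub1 p q * (p ^ 2 * y) - cub2 p q * (p ^ 2 * y) ^ 2 + cub3 p q * (p ^ 2 * y) ^ 3 =
        complex_of_real (cub0 p' r + cub1 p' r * z - cub2 p' r * z ^ 2 + cub3 p' r * z ^ 3)"
      unfolding yz unfolding pr qr cub0_def cub1_def cub2_def cub3_def by simp
    then show ?thesis using pos by (metis less_irrefl of_real_eq_0_iff)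
  qed
  ultimately have y1: "y = 1" by blast
  have th1': "\<theta> 1 = q ^ 4 * p ^ 2 - (q + 1) * q ^ 3 * p + q" using th1 y1 by simp

  \<comment> \<open>Stated for a general \<open>W\<close> because this entry is the one used for
    both \<open>S\<close> and \<open>T\<close>.\<close>
  have row1_col0: "b 1 * (w 2 * w 0) + m * (w 0 * w 0) + a 1 * (w 1 * w 0) = \<theta> 1 * (w 1 * w 1)"
    if "W \<in> carrier_mat (d + 1) (d + 1)" "diagonal_mat W" "L * (W * P * W) = W * P * W * L"
      "\<And>i. i \<le> d \<Longrightarrow> W $$ (i, i) = w i" for W w
  proof -
    have "b 1 * (w 2 * P $$ (2, 0) * w 0) + m * (w 0 * P $$ (0, 0) * w 0) + a 1 * (w 1 * P $$ (1, 0) * w 0)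
        = w 1 * P $$ (1, 1) * w 1 * m"
      using diag_conj_entry[OF that(1-3), of 1 0] that(4) d3 c_1 a_0 by (simp add: numeral_2_eq_2)
    then show ?thesis using P_0[of 0] P_0[of 1] P_0[of 2] d3 unfolding \<theta>_def by simp
  qed
  have e1: "b 1 * (s 2 * s 0) + m * (s 0 * s 0) + a 1 * (s 1 * s 0) = \<theta> 1 * (s 1 * s 1)"
    using row1_col0[OF S comm(2) Ss] .
  have "b 1 * (t 2 * t 0) + m * (t 0 * t 0) + a 1 * (t 1 * t 0) = \<theta> 1 * (t 1 * t 1)"
    by (rule row1_col0[OF T comm(3)]) (simp add: t_def)
  then have e1': "b 1 * (inverse (s 2) * inverse (s 0)) + m * (inverse (s 0) * inverse (s 0))
      + a 1 * (inverse (s 1) * inverse (s 0)) = \<theta> 1 * (inverse (s 1) * inverse (s 1))"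
    using s(2) d3 by simp
  have "b 2 * (s 3 * P $$ (3, 0) * s 0) + c 2 * (s 1 * P $$ (1, 0) * s 0) + a 2 * (s 2 * P $$ (2, 0) * s 0)
      = s 2 * P $$ (2, 1) * s 1 * m"
    using diag_conj_entry[OF S comm(2), of 2 0] Ss d3 c_1 a_0 by (simp add: numeral_3_eq_3 numeral_2_eq_2)
  then have e2: "b 2 * (s 3 * s 0) + c 2 * (s 1 * s 0) + a 2 * (s 2 * s 0) = \<theta> 2 * (s 2 * s 1)"
    using P_0[of 1] P_0[of 2] P_0[of 3] d3 unfolding \<theta>_def by simp
  have "b 2 * (s 3 * P $$ (3, 1) * s 1) + c 2 * (s 1 * P $$ (1, 1) * s 1) + a 2 * (s 2 * P $$ (2, 1) * s 1)
      = s 2 * P $$ (2, 0) * s 0 * b 0 + s 2 * P $$ (2, 2) * s 2 * c 2 + s 2 * P $$ (2, 1) * s 1 * a 1"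
    using diag_conj_entry[OF S comm(2), of 2 1] Ss d3 by (simp add: numeral_3_eq_3 numeral_2_eq_2)
  then have "b 2 * (s 3 * P $$ (3, 1) * s 1) + c 2 * (s 1 * P $$ (1, 1) * s 1) + a 2 * (s 2 * P $$ (2, 1) * s 1)
      = s 2 * s 0 * b 0 + s 2 * P $$ (2, 2) * s 2 * c 2 + s 2 * P $$ (2, 1) * s 1 * a 1"
    using P_0[of 2] d3 by simp
  moreover have "\<beta> * (M * x3 * (u3 * u1)) + \<gamma> * (M * x1 * (u1 * u1)) + \<alpha> * (M * x2 * (u2 * u1))
      = M * \<beta>0 * (u2 * u0) + \<alpha>1 * (M * x2 * (u2 * u1)) + \<gamma> * (M * x22) * (u2 * u2)"
    if "\<beta> * (u3 * x3 * u1) + \<gamma> * (u1 * x1 * u1) + \<alpha> * (u2 * x2 * u1)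
      = u2 * u0 * \<beta>0 + u2 * x22 * u2 * \<gamma> + u2 * x2 * u1 * \<alpha>1"
    for \<alpha> \<beta> \<gamma> \<beta>0 \<alpha>1 M x1 x2 x3 x22 u0 u1 u2 u3 :: complex
    using arg_cong[OF that, of "\<lambda>x. M * x"] by (simp add: algebra_simps)
  ultimately have e3: "b 2 * (\<theta> 3 * (s 3 * s 1)) + c 2 * (\<theta> 1 * (s 1 * s 1)) + a 2 * (\<theta> 2 * (s 2 * s 1))
      = m * b 0 * (s 2 * s 0) + a 1 * (\<theta> 2 * (s 2 * s 1)) + c 2 * (m * P $$ (2, 2)) * (s 2 * s 2)"
    unfolding \<theta>_def by blast
  show False
    using modular_contradiction[OF refl b0 b1 b2 c2 a1 a2 th1' r1 r2 g q0 p0 m0 bnz qk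
        s(1) s(1) s(1) s(1) e1 e1' e2 e3] d3 by simp
qed

end

theorem theorem4:
  fixes N :: nat and P :: "complex mat"
  assumes "N > 5"
    and "self_dual_eigenmatrix (alt_forms N :: 'a :: {field, finite} mat set)
           (alt_rel N) (N div 2) P"
  shows "\<not> (\<exists>T \<in> carrier_mat (N div 2 + 1) (N div 2 + 1).
            diagonal_mat T \<and> (P * T) ^\<^sub>m 3 = 1\<^sub>m (N div 2 + 1))"
proof -
  obtain E :: "nat \<Rightarrow> 'a mat \<Rightarrow> 'a mat \<Rightarrow> complex"
    where "primitive_idempotents (alt_forms N) (alt_rel N) (N div 2) E"
      "first_eigenmatrix (alt_forms N) (alt_rel N) (N div 2) E P"
      "second_eigenmatrix (alt_forms N) (alt_rel N) (N div 2) E P"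
    using assms(2) unfolding self_dual_eigenmatrix_def by blast
  then interpret alt_eigen N "N div 2" E P "of_nat CARD('a)"
    by unfold_locales (use assms(1) in auto)
  show ?thesis using no_modular_diagonal[OF assms(1)] by blast
qed

end
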